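(* Let $H_1,H_2$ be self-adjoint operators, bounded below, on Hilbert spaces $V_1,V_2$, with $\lambda_0(H_j)=\inf\operatorname{spec}(H_j)$. Let $H=H_1\otimes\mathrm{Id}+\mathrm{Id}\otimes H_2$ be the associated self-adjoint operator on the completed Hilbert space tensor product $V_1\hat\otimes V_2$. Let $R_j(\nu)=(H_j-\nu)^{-1}$ and $R(\nu)=(H-\nu)^{-1}$ denote the resolvents. Let $\mu\in\mathbb{C}\setminus[\lambda_0(H_1)+\lambda_0(H_2),\infty)$. Let $\gamma:\mathbb{R}\to\mathbb{C}$ be a (piecewise smooth) parametrized curve which does not intersect $[\lambda_0(H_1),\infty)\cup\big(\mu-[\lambda_0(H_2),\infty)\big)$ and for which there are $T>0$ and constants $c_\pm\in\mathbb{C}$ with $\operatorname{Im}c_\pm>0$ such that $\gamma(t)=c_\pm t$ for $\pm t\ge T$. Then $$R(\mu)=\frac{1}{2\pi i}\int_\gamma R_1(\mu_1)\,R_2(\mu-\mu_1)\,d\mu_1 ,$$ where $R_1(\mu_1)R_2(\mu-\mu_1)$ means $R_1(\mu_1)\otimes R_2(\mu-\mu_1)$ acting on $V_1\hat\otimes V_2$, $\gamma$ is traversed in the direction of increasing $t$, and the integral converges in the space of bounded operators.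
   Context: For a set $A\subset\mathbb{C}$, $\mu-A=\{\mu-a: a\in A\}$. Since $H_1\otimes\mathrm{Id}$ and $\mathrm{Id}\otimes H_2$ commute, $\inf\operatorname{spec}(H)=\lambda_0(H_1)+\lambda_0(H_2)$. *)

theory Defs
  imports "HOL-Analysis.Analysis"
begin

section \<open>Complex Hilbert spaces\<close>

text \<open>The inner product is conjugate-linear in the first argument. Positivity and
  definiteness are contained in the last axiom, since \<open>norm\<close> is a norm.\<close>

class complex_inner = real_normed_vector +
  fixes scaleC :: "complex \<Rightarrow> 'a \<Rightarrow> 'a"  (infixr "*\<^sub>C" 75)
    and cinner :: "'a \<Rightarrow> 'a \<Rightarrow> complex"
  assumes scaleC_add_right: "c *\<^sub>C (x + y) = c *\<^sub>C x + c *\<^sub>C y"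
    and scaleC_add_left: "(c + d) *\<^sub>C x = c *\<^sub>C x + d *\<^sub>C x"
    and scaleC_scaleC: "c *\<^sub>C d *\<^sub>C x = (c * d) *\<^sub>C x"
    and scaleC_of_real: "complex_of_real r *\<^sub>C x = r *\<^sub>R x"
    and cinner_commute: "cinner x y = cnj (cinner y x)"
    and cinner_add_right: "cinner x (y + z) = cinner x y + cinner x z"
    and cinner_scaleC_right: "cinner x (c *\<^sub>C y) = c * cinner x y"
    and cinner_self: "cinner x x = complex_of_real ((norm x)\<^sup>2)"

class complex_hilbert = complex_inner + complete_space

subclass (in complex_hilbert) banach ..

instantiation complex :: complex_hilbert
begin

definition scaleC_complex :: "complex \<Rightarrow> complex \<Rightarrow> complex"
  where "scaleC_complex c x = c * x"

definition cinner_complex :: "complex \<Rightarrow> complex \<Rightarrow> complex"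
  where "cinner_complex x y = cnj x * y"

instance
  by standard
    (auto simp: scaleC_complex_def cinner_complex_def algebra_simps scaleR_conv_of_real
      complex_norm_square simp flip: of_real_power)

end

lemma cinner_scaleC_left: "cinner (c *\<^sub>C x) y = cnj c * cinner x y"
  by (metis cinner_commute cinner_scaleC_right complex_cnj_mult)

lemma norm_scaleC: "norm (c *\<^sub>C x) = cmod c * norm (x::'a::complex_inner)"
proof -
  have "complex_of_real ((norm (c *\<^sub>C x))\<^sup>2) = c * (cnj c * cinner x x)"
    by (simp only: cinner_scaleC_left cinner_scaleC_right flip: cinner_self)
  also have "\<dots> = complex_of_real ((cmod c * norm x)\<^sup>2)"
    by (simp add: cinner_self power_mult_distrib flip: complex_norm_square)
  finally have "(norm (c *\<^sub>C x))\<^sup>2 = (cmod c * norm x)\<^sup>2"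
    using of_real_eq_iff by blast
  then show ?thesis
    by (simp add: power2_eq_iff_nonneg)
qed

lemma bounded_linear_scaleC: "bounded_linear (\<lambda>x::'a::complex_inner. c *\<^sub>C x)"
proof (rule bounded_linear_intro[where K = "cmod c"])
  show "c *\<^sub>C (r *\<^sub>R x) = r *\<^sub>R c *\<^sub>C x" for r and x :: 'a
    by (simp add: scaleC_scaleC mult.commute flip: scaleC_of_real)
qed (simp_all add: scaleC_add_right norm_scaleC mult.commute)

section \<open>Unbounded operators\<close>

text \<open>A possibly unbounded operator is identified with its graph, a subset of \<open>V \<times> V\<close>:
  \<open>(x, y) \<in> H\<close> means that \<open>x\<close> lies in the domain of \<open>H\<close> and \<open>H x = y\<close>.\<close>

type_synonym 'a operator = "('a \<times> 'a) set"

definition linear_operator :: "'a::complex_inner operator \<Rightarrow> bool" where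
  "linear_operator H \<longleftrightarrow>
     single_valued H \<and> subspace H \<and> (\<forall>c x y. (x, y) \<in> H \<longrightarrow> (c *\<^sub>C x, c *\<^sub>C y) \<in> H)"

definition adjoint_operator :: "'a::complex_inner operator \<Rightarrow> 'a operator" where
  "adjoint_operator H = {(y, z). \<forall>(x, w) \<in> H. cinner y w = cinner z x}"

definition self_adjoint :: "'a::complex_inner operator \<Rightarrow> bool" where
  "self_adjoint H \<longleftrightarrow>
     linear_operator H \<and> closure (Domain H) = UNIV \<and> adjoint_operator H = H"

definition bounded_below :: "'a::complex_inner operator \<Rightarrow> bool" where
  "bounded_below H \<longleftrightarrow> (\<exists>m::real. \<forall>(x, y) \<in> H. m * (norm x)\<^sup>2 \<le> Re (cinner x y))"

text \<open>\<open>B\<close> is an everywhere defined bounded two-sided inverse of \<open>H - \<nu>\<close>: the graph of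
  \<open>H - \<nu>\<close> is the transposed graph of \<open>B\<close>. If \<open>H\<close> is complex linear then so is \<open>B\<close>,
  although the type \<open>\<Rightarrow>\<^sub>L\<close> only records real linearity.\<close>

definition is_resolvent :: "'a::complex_inner operator \<Rightarrow> complex \<Rightarrow> ('a \<Rightarrow>\<^sub>L 'a) \<Rightarrow> bool" where
  "is_resolvent H \<nu> B \<longleftrightarrow>
     {(x, y - \<nu> *\<^sub>C x) | x y. (x, y) \<in> H} = {(blinfun_apply B y, y) | y. True}"

definition resolvent_set :: "'a::complex_inner operator \<Rightarrow> complex set" where
  "resolvent_set H = {\<nu>. \<exists>B. is_resolvent H \<nu> B}"

definition resolvent :: "'a::complex_inner operator \<Rightarrow> complex \<Rightarrow> ('a \<Rightarrow>\<^sub>L 'a)" where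
  "resolvent H \<nu> = (THE B. is_resolvent H \<nu> B)"

lemma resolvent_eqI:
  assumes "is_resolvent H \<nu> B"
  shows "resolvent H \<nu> = B"
  unfolding resolvent_def
proof (rule the_equality)
  fix C assume "is_resolvent H \<nu> C"
  with assms have "{(blinfun_apply C y, y) | y. True} = {(blinfun_apply B y, y) | y. True}"
    by (simp add: is_resolvent_def)
  then show "C = B"
    by (intro blinfun_eqI) (auto simp: set_eq_iff)
qed fact

definition op_spectrum :: "'a::complex_inner operator \<Rightarrow> complex set" where
  "op_spectrum H = - resolvent_set H"

text \<open>The spectrum of a self-adjoint operator is real. The infimum is extended-real valued
  so that it is \<open>\<infinity>\<close> when the spectrum is empty, i.e. on the zero Hilbert space.\<close>

definition inf_spec :: "'a::complex_inner operator \<Rightarrow> ereal" where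
  "inf_spec H = (INF x \<in> {x::real. complex_of_real x \<in> op_spectrum H}. ereal x)"

definition right_ray :: "ereal \<Rightarrow> complex set" where
  "right_ray l = {complex_of_real x | x. l \<le> ereal x}"

section \<open>Tensor products\<close>

text \<open>\<open>tensor\<close> exhibits \<open>'c\<close> as the completed tensor product of \<open>'a\<close> and \<open>'b\<close>, which
  determines \<open>'c\<close> up to a unique unitary compatible with \<open>tensor\<close>. The set of elementary
  tensors is closed under complex scalars, so its real span is its complex span, i.e. the
  algebraic tensor product.\<close>

definition hilbert_tensor_product ::
    "('a::complex_hilbert \<Rightarrow> 'b::complex_hilbert \<Rightarrow> 'c::complex_hilbert) \<Rightarrow> bool" where
  "hilbert_tensor_product tensor \<longleftrightarrow>
     (\<forall>x x' y. tensor (x + x') y = tensor x y + tensor x' y) \<and>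
     (\<forall>x y y'. tensor x (y + y') = tensor x y + tensor x y') \<and>
     (\<forall>c x y. tensor (c *\<^sub>C x) y = c *\<^sub>C tensor x y) \<and>
     (\<forall>c x y. tensor x (c *\<^sub>C y) = c *\<^sub>C tensor x y) \<and>
     (\<forall>x x' y y'. cinner (tensor x y) (tensor x' y') = cinner x x' * cinner y y') \<and>
     closure (span {tensor x y | x y. True}) = UNIV"

definition tensor_blinfun ::
    "('a::complex_hilbert \<Rightarrow> 'b::complex_hilbert \<Rightarrow> 'c::complex_hilbert)
      \<Rightarrow> ('a \<Rightarrow>\<^sub>L 'a) \<Rightarrow> ('b \<Rightarrow>\<^sub>L 'b) \<Rightarrow> ('c \<Rightarrow>\<^sub>L 'c)" where
  "tensor_blinfun tensor A B =
     (THE C. \<forall>x y. blinfun_apply C (tensor x y) = tensor (blinfun_apply A x) (blinfun_apply B y))"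

lemma tensor_blinfun_eqI:
  assumes tensor: "hilbert_tensor_product tensor"
    and C: "\<And>x y. blinfun_apply C (tensor x y) = tensor (blinfun_apply A x) (blinfun_apply B y)"
  shows "tensor_blinfun tensor A B = C"
  unfolding tensor_blinfun_def
proof (rule the_equality)
  fix D
  assume D: "\<forall>x y. blinfun_apply D (tensor x y) = tensor (blinfun_apply A x) (blinfun_apply B y)"
  let ?S = "span {tensor x y | x y. True}"
  have span: "blinfun_apply D z = blinfun_apply C z" if "z \<in> ?S" for z
    by (rule linear_eq_on[OF _ _ that])
      (use C D in \<open>auto intro: bounded_linear.linear blinfun.bounded_linear_right\<close>)
  have "closed {z. blinfun_apply D z = blinfun_apply C z}"
    by (intro closed_Collect_eq continuous_intros)
  then have "closure ?S \<subseteq> {z. blinfun_apply D z = blinfun_apply C z}"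
    using span by (intro closure_minimal) auto
  then show "D = C"
    using tensor by (intro blinfun_eqI) (auto simp: hilbert_tensor_product_def)
qed (use C in blast)

text \<open>\<open>H\<^sub>1 \<otimes> Id + Id \<otimes> H\<^sub>2\<close> is the closure of the operator defined on the algebraic tensor
  product of the domains. The generating pairs are closed under complex scalars, so the real
  span is again the complex span.\<close>

definition tensor_sum ::
    "('a::complex_hilbert \<Rightarrow> 'b::complex_hilbert \<Rightarrow> 'c::complex_hilbert)
      \<Rightarrow> 'a operator \<Rightarrow> 'b operator \<Rightarrow> 'c operator" where
  "tensor_sum tensor H\<^sub>1 H\<^sub>2 =
     closure (span {(tensor x y, tensor u y + tensor x v) | x u y v. (x, u) \<in> H\<^sub>1 \<and> (y, v) \<in> H\<^sub>2})"

section \<open>Operator-valued curve integrals\<close>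

definition scaleC_blinfun ::
    "complex \<Rightarrow> ('a::real_normed_vector \<Rightarrow>\<^sub>L 'b::complex_inner) \<Rightarrow> ('a \<Rightarrow>\<^sub>L 'b)" where
  "scaleC_blinfun c A = Blinfun (\<lambda>x. c *\<^sub>C blinfun_apply A x)"

lemma blinfun_apply_scaleC_blinfun:
  "blinfun_apply (scaleC_blinfun c A) x = c *\<^sub>C blinfun_apply A x"
  unfolding scaleC_blinfun_def
  by (subst bounded_linear_Blinfun_apply)
    (auto intro: bounded_linear_compose[OF bounded_linear_scaleC] blinfun.bounded_linear_right)

text \<open>For a curve parametrized by the whole real line. Integrals over \<open>UNIV\<close> are
  Henstock--Kurzweil integrals with respect to the operator norm. They include improper
  integrals, and the finitely many points where the curve fails to be differentiable
  are negligible.\<close>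

definition curve_integrand ::
    "(real \<Rightarrow> complex) \<Rightarrow> (complex \<Rightarrow> ('c::complex_hilbert \<Rightarrow>\<^sub>L 'c)) \<Rightarrow> real \<Rightarrow> ('c \<Rightarrow>\<^sub>L 'c)" where
  "curve_integrand \<gamma> F t = scaleC_blinfun (vector_derivative \<gamma> (at t)) (F (\<gamma> t))"

definition curve_integrable ::
    "(real \<Rightarrow> complex) \<Rightarrow> (complex \<Rightarrow> ('c::complex_hilbert \<Rightarrow>\<^sub>L 'c)) \<Rightarrow> bool" where
  "curve_integrable \<gamma> F \<longleftrightarrow> curve_integrand \<gamma> F integrable_on UNIV"

definition curve_integral ::
    "(real \<Rightarrow> complex) \<Rightarrow> (complex \<Rightarrow> ('c::complex_hilbert \<Rightarrow>\<^sub>L 'c)) \<Rightarrow> ('c \<Rightarrow>\<^sub>L 'c)" where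
  "curve_integral \<gamma> F = integral UNIV (curve_integrand \<gamma> F)"

end

(*
The integrand is F(z) = R1(z) \<otimes> R2(\<mu> - z). For x, y in the domains and \<zeta> = (H - \<mu>)(x \<otimes> y),
the operator H - \<mu> maps F(z)(x \<otimes> y) to F(z) \<zeta> = x \<otimes> R2(\<mu> - z) y + R1(z) x \<otimes> y.
Tested against a vector, each summand is holomorphic on a slit plane, hence has a primitive there,
and this primitive behaves like a logarithm at infinity, because R1(z) x = x / (a - z) + O(1 / |z|^2)
away from the spectrum. Evaluating the primitives at the two ends of the curve gives
\<integral> F(z) \<zeta> dz = 2 \<pi> i (x \<otimes> y), so that no contour has to be closed or deformed. Since H is closed,
B = (2 \<pi> i)^(-1) \<integral> F(z) dz then satisfies (H - \<mu>) B = 1 and B (H - \<mu>) = 1 on dense sets, and hence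
everywhere.
*)
theory Submission
  imports Defs "HOL-Complex_Analysis.Complex_Analysis"
begin

section \<open>Complex Hilbert spaces\<close>

text \<open>No spectral theorem enters: all resolvent estimates are the two elementary bounds 1 /
  |Im z| and 1 / (m - Re z), with m a lower bound of the quadratic form. They make F(z) of order 1 /
  t^2 along the ends of the curve, but each of the two summands of F(z) \<zeta> is only of order 1 /
  |z|. The summands are therefore never integrated separately; their primitives are compared at the
  points with parameters n and -n, where the divergent terms ln n cancel.

  The curve comes from the lower half-plane and leaves through the upper one, in directions governed
  by two numbers c in the upper half-plane, for which Ln c - Ln (-c) = \<pi> i. Each primitive
  contributes \<pi> i plus or minus the same difference of logarithms of these numbers. The signs
  are opposite because the second primitive is taken at \<mu> - z, so the sum is 2 \<pi> i whatever
  the two directions are.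

  A separate obstacle is that R1 \<otimes> R2 has to be shown to exist as a bounded operator: a norm
  bound on finite sums of tensors must not depend on how the sum is written.\<close>

lemma cinner_add_left: "cinner (x + y) z = cinner x z + cinner y z"
  by (metis cinner_add_right cinner_commute complex_cnj_add)

lemma Re_cinner_self: "Re (cinner x x) = (norm x)\<^sup>2"
  by (simp add: cinner_self)

lemma scaleC_one [simp]: "1 *\<^sub>C x = x"
  using scaleC_of_real[of 1 x] by simp

lemma bounded_bilinear_scaleC: "bounded_bilinear (scaleC :: complex \<Rightarrow> 'a::complex_inner \<Rightarrow> 'a)"
proof
  show "(r *\<^sub>R c) *\<^sub>C x = r *\<^sub>R c *\<^sub>C x" for r c and x :: 'a
    by (simp add: scaleR_conv_of_real flip: scaleC_of_real scaleC_scaleC)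
  show "c *\<^sub>C r *\<^sub>R x = r *\<^sub>R c *\<^sub>C x" for r c and x :: 'a
    by (simp add: scaleC_scaleC mult.commute flip: scaleC_of_real)
  show "\<exists>K. \<forall>c x. norm (c *\<^sub>C x :: 'a) \<le> norm c * norm x * K"
    by (intro exI[of _ 1]) (simp add: norm_scaleC)
qed (simp_all add: scaleC_add_right scaleC_add_left)

interpretation scaleC: bounded_bilinear "scaleC :: complex \<Rightarrow> 'a::complex_inner \<Rightarrow> 'a"
  by (rule bounded_bilinear_scaleC)

lemma cinner_diff_right: "cinner x (y - z) = cinner x y - cinner x z"
  by (metis add_diff_cancel_right' cinner_add_right diff_add_cancel)

lemma cinner_diff_left: "cinner (x - y) z = cinner x z - cinner y z"
  by (metis add_diff_cancel_right' cinner_add_left diff_add_cancel)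

text \<open>Pythagoras for the orthogonal projection of \<open>w\<close> onto the line through
  \<open>v\<close>. Nonnegativity of the left side gives Cauchy-Schwarz; the strict decrease when
  \<open>cinner v w\<close> is nonzero gives orthogonality of nearest points.\<close>

lemma norm_diff_scaleC_sq:
  fixes v w :: "'a::complex_inner"
  assumes "v \<noteq> 0"
  shows "(norm (w - (cinner v w / (norm v)\<^sup>2) *\<^sub>C v))\<^sup>2 = (norm w)\<^sup>2 - (cmod (cinner v w))\<^sup>2 / (norm v)\<^sup>2"
proof -
  let ?p = "cinner v w" and ?q = "complex_of_real ((norm v)\<^sup>2)"
  have q: "?q \<noteq> 0" using assms by simp
  have "complex_of_real ((norm (w - (?p / ?q) *\<^sub>C v))\<^sup>2)
      = cinner (w - (?p / ?q) *\<^sub>C v) (w - (?p / ?q) *\<^sub>C v)"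
    by (simp only: cinner_self)
  also have "\<dots> = cinner w w - (?p / ?q) * cinner w v - cnj (?p / ?q) * ?p
      + cnj (?p / ?q) * (?p / ?q) * cinner v v"
    by (simp add: cinner_diff_right cinner_diff_left
        cinner_scaleC_left cinner_scaleC_right algebra_simps)
  also have "\<dots> = cinner w w - ?p * cnj ?p / ?q"
    using q by (simp add: cinner_self cinner_commute[of w v] field_simps flip: of_real_power)
  also have "\<dots> = complex_of_real ((norm w)\<^sup>2 - (cmod ?p)\<^sup>2 / (norm v)\<^sup>2)"
    by (simp add: cinner_self complex_norm_square flip: of_real_power)
  finally show ?thesis
    using of_real_eq_iff by blast
qed

lemma cinner_Cauchy_Schwarz: "cmod (cinner x y) \<le> norm x * norm (y :: 'a::complex_inner)"
proof (cases "x = 0")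
  case False
  have "0 \<le> (norm y)\<^sup>2 - (cmod (cinner x y))\<^sup>2 / (norm x)\<^sup>2"
    using norm_diff_scaleC_sq[OF False, of y] by (metis zero_le_power2)
  then have "(cmod (cinner x y))\<^sup>2 \<le> (norm x * norm y)\<^sup>2"
    using False by (simp add: field_simps)
  then show ?thesis
    by (rule power2_le_imp_le) simp
qed (use cinner_diff_left[of 0 0 y] in simp)

lemma bounded_bilinear_cinner: "bounded_bilinear (cinner :: 'a::complex_inner \<Rightarrow> 'a \<Rightarrow> complex)"
proof
  show "cinner (r *\<^sub>R x) y = r *\<^sub>R cinner x y" for r and x y :: 'a
    by (simp add: scaleR_conv_of_real cinner_scaleC_left flip: scaleC_of_real)
  show "cinner x (r *\<^sub>R y) = r *\<^sub>R cinner x y" for r and x y :: 'a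
    by (simp add: scaleR_conv_of_real cinner_scaleC_right flip: scaleC_of_real)
  show "\<exists>K. \<forall>x y :: 'a. norm (cinner x y) \<le> norm x * norm y * K"
    by (intro exI[of _ 1]) (simp add: cinner_Cauchy_Schwarz)
qed (simp_all add: cinner_add_right cinner_add_left)

interpretation cinner: bounded_bilinear "cinner :: 'a::complex_inner \<Rightarrow> 'a \<Rightarrow> complex"
  by (rule bounded_bilinear_cinner)

lemmas [continuous_intros] = scaleC.continuous_on scaleC.continuous cinner.continuous_on cinner.continuous

section \<open>Orthogonal projection onto closed subspaces\<close>

lemma norm_add_sq: "(norm (x + y))\<^sup>2 = (norm x)\<^sup>2 + 2 * Re (cinner x y) + (norm (y :: 'a::complex_inner))\<^sup>2"
proof -
  have "Re (cinner y x) = Re (cinner x y)"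
    by (subst cinner_commute) simp
  then show ?thesis
    by (simp add: cinner.add_left cinner.add_right flip: Re_cinner_self)
qed

lemma parallelogram:
  "(norm (x + y))\<^sup>2 + (norm (x - y))\<^sup>2 = 2 * (norm x)\<^sup>2 + 2 * (norm (y :: 'a::complex_inner))\<^sup>2"
  using norm_add_sq[of x y] norm_add_sq[of x "- y"] by (simp add: cinner.minus_right)

lemma cinner_eq_0_imp: "(\<And>v. cinner v w = 0) \<Longrightarrow> w = 0"
  using cinner_self[of w] by simp

text \<open>The parallelogram law forces a minimizing sequence to be Cauchy: midpoints stay in
  \<open>S\<close> and so cannot be closer to \<open>y\<close> than the infimum.\<close>

lemma nearest_point_exists:
  fixes S :: "'a::complex_hilbert set"
  assumes S: "subspace S" "closed S"
  obtains s where "s \<in> S" "dist y s = infdist y S"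
proof -
  define d where "d = infdist y S"
  have ne: "S \<noteq> {}" using subspace_0[OF S(1)] by blast
  have dle: "d \<le> dist y v" if "v \<in> S" for v
    unfolding d_def using that by (rule infdist_le)
  have d0: "0 \<le> d" by (simp add: d_def infdist_nonneg)
  have "\<exists>v\<in>S. dist y v < d + 1 / Suc n" for n
  proof -
    have "Inf (dist y ` S) < d + 1 / Suc n"
      unfolding d_def infdist_def using ne by simp
    then show ?thesis
      using cInf_lessD[of "dist y ` S"] ne by auto
  qed
  then obtain s where s: "\<And>n. s n \<in> S" "\<And>n. dist y (s n) < d + 1 / Suc n"
    by metis
  \<comment> \<open>The bound is 4 (d + e)^2 - 4 d^2 = 8 d e + 4 e^2 with e = 1 / (N + 1); one
    factor e of the square is dropped because e \<le> 1.\<close>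
  have close: "(dist (s m) (s n))\<^sup>2 \<le> (8 * d + 4) * (1 / Suc N)" if "N \<le> m" "N \<le> n" for m n N
  proof -
    define e where "e = 1 / real (Suc N)"
    have e: "0 < e" "e \<le> 1" by (auto simp: e_def)
    have le: "norm (y - s k) \<le> d + e" if "N \<le> k" for k
    proof -
      have "1 / real (Suc k) \<le> e" unfolding e_def using that by (simp add: frac_le)
      then show ?thesis using s(2)[of k] by (simp add: dist_norm)
    qed
    have mid: "(1/2) *\<^sub>R (s m + s n) \<in> S"
      by (intro subspace_mul subspace_add S s)
    have "2 * d \<le> norm ((y - s m) + (y - s n))"
    proof -
      have "2 * d \<le> 2 * norm (y - (1/2) *\<^sub>R (s m + s n))"
        using dle[OF mid] by (simp add: dist_norm)
      also have "\<dots> = norm (2 *\<^sub>R (y - (1/2) *\<^sub>R (s m + s n)))" by simp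
      also have "2 *\<^sub>R (y - (1/2) *\<^sub>R (s m + s n)) = (y - s m) + (y - s n)"
        by (simp add: algebra_simps scaleR_2)
      finally show ?thesis .
    qed
    then have "4 * d\<^sup>2 \<le> (norm ((y - s m) + (y - s n)))\<^sup>2"
      using d0 power_mono[of "2 * d" _ 2] by simp
    moreover have "(norm (y - s m))\<^sup>2 \<le> (d + e)\<^sup>2" "(norm (y - s n))\<^sup>2 \<le> (d + e)\<^sup>2"
      using le that by (simp_all add: power_mono)
    moreover have "norm ((y - s m) - (y - s n)) = dist (s m) (s n)"
      by (simp add: dist_norm norm_minus_commute)
    ultimately have "(dist (s m) (s n))\<^sup>2 \<le> 4 * (d + e)\<^sup>2 - 4 * d\<^sup>2"
      using parallelogram[of "y - s m" "y - s n"] by simp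
    also have "\<dots> = 8 * d * e + 4 * e * e"
      by (simp add: power2_eq_square algebra_simps)
    also have "\<dots> \<le> (8 * d + 4) * e"
      using e by (simp add: algebra_simps)
    finally show ?thesis by (simp add: e_def)
  qed
  have "Cauchy s"
  proof (rule metric_CauchyI)
    fix e :: real assume e: "0 < e"
    have "(\<lambda>N. (8 * d + 4) * (1 / Suc N)) \<longlonglongrightarrow> (8 * d + 4) * 0"
      by (intro tendsto_mult tendsto_const) (use LIMSEQ_inverse_real_of_nat in \<open>simp add: inverse_eq_divide\<close>)
    then have "\<forall>\<^sub>F N in sequentially. (8 * d + 4) * (1 / Suc N) < e\<^sup>2"
      using e by (intro order_tendstoD) auto
    then obtain N where N: "(8 * d + 4) * (1 / Suc N) < e\<^sup>2"
      unfolding eventually_sequentially by blast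
    have "dist (s m) (s n) < e" if "N \<le> m" "N \<le> n" for m n
      using le_less_trans[OF close[OF that] N] e by (auto intro: power2_less_imp_less)
    then show "\<exists>M. \<forall>m\<ge>M. \<forall>n\<ge>M. dist (s m) (s n) < e" by blast
  qed
  then obtain l where l: "s \<longlonglongrightarrow> l"
    using Cauchy_convergent convergent_def by blast
  have lS: "l \<in> S" using S(2) s(1) l closed_sequentially by blast
  have "dist y l \<le> d + 0"
  proof (rule LIMSEQ_le)
    show "(\<lambda>n. dist y (s n)) \<longlonglongrightarrow> dist y l" by (intro tendsto_intros l)
    show "(\<lambda>n. d + 1 / Suc n) \<longlonglongrightarrow> d + 0"
      by (intro tendsto_intros) (use LIMSEQ_inverse_real_of_nat in \<open>simp add: inverse_eq_divide\<close>)
  qed (use s(2) less_imp_le in blast)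
  with dle[OF lS] have "dist y l = d" by simp
  with lS show thesis unfolding d_def by (rule that)
qed

text \<open>If \<open>s\<close> is nearest to \<open>y\<close>, then \<open>y - s\<close> is
  orthogonal to \<open>S\<close>, since otherwise adding a suitable complex multiple of some
  \<open>v\<close> to \<open>s\<close> would bring it closer. This is where closure under complex
  scalars enters, as \<open>subspace\<close> is a real notion.\<close>

lemma closed_subspace_eq_UNIV:
  fixes S :: "'a::complex_hilbert set"
  assumes S: "subspace S" "closed S" and C: "\<And>c x. x \<in> S \<Longrightarrow> c *\<^sub>C x \<in> S"
    and orth: "\<And>w. (\<And>v. v \<in> S \<Longrightarrow> cinner v w = 0) \<Longrightarrow> w = 0"
  shows "S = UNIV"
proof -
  have "y \<in> S" for y
  proof -
    obtain s where s: "s \<in> S" "dist y s = infdist y S"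
      using nearest_point_exists[OF S] .
    have "cinner v (y - s) = 0" if v: "v \<in> S" for v
    proof (cases "v = 0")
      case False
      let ?c = "cinner v (y - s) / complex_of_real ((norm v)\<^sup>2)"
      have "s + ?c *\<^sub>C v \<in> S" by (intro subspace_add S s C v)
      then have "norm (y - s) \<le> norm (y - s - ?c *\<^sub>C v)"
        using infdist_le[of _ S y] s(2) by (simp add: dist_norm diff_diff_eq)
      then have "(norm (y - s))\<^sup>2 \<le> (norm (y - s))\<^sup>2 - (cmod (cinner v (y - s)))\<^sup>2 / (norm v)\<^sup>2"
        using norm_diff_scaleC_sq[OF False, of "y - s"] by (metis norm_ge_zero power_mono)
      with False show ?thesis by (simp add: divide_le_0_iff)
    qed (simp add: cinner.zero_left)
    then have "y - s = 0" by (rule orth)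
    with s(1) show ?thesis by simp
  qed
  then show ?thesis by auto
qed

section \<open>Self-adjoint operators and their resolvents\<close>

text \<open>The two inclusions between the graphs, read as left inverse on the domain and right
  inverse everywhere. All later arguments use this form.\<close>

lemma is_resolvent_iff:
  "is_resolvent H \<nu> B \<longleftrightarrow>
     (\<forall>x u. (x, u) \<in> H \<longrightarrow> blinfun_apply B (u - \<nu> *\<^sub>C x) = x) \<and>
     (\<forall>y. (blinfun_apply B y, y + \<nu> *\<^sub>C blinfun_apply B y) \<in> H)"
proof
  assume "is_resolvent H \<nu> B"
  then have eq: "{(x, y - \<nu> *\<^sub>C x) | x y. (x, y) \<in> H} = {(blinfun_apply B y, y) | y. True}"
    by (simp add: is_resolvent_def)
  have "blinfun_apply B (u - \<nu> *\<^sub>C x) = x" if "(x, u) \<in> H" for x u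
  proof -
    have "(x, u - \<nu> *\<^sub>C x) \<in> {(blinfun_apply B y, y) | y. True}"
      using that by (subst eq[symmetric]) blast
    then show ?thesis by auto
  qed
  moreover have "(blinfun_apply B y, y + \<nu> *\<^sub>C blinfun_apply B y) \<in> H" for y
  proof -
    have "(blinfun_apply B y, y) \<in> {(x, y - \<nu> *\<^sub>C x) | x y. (x, y) \<in> H}"
      by (subst eq) blast
    then obtain u where "(blinfun_apply B y, u) \<in> H" "y = u - \<nu> *\<^sub>C blinfun_apply B y" by auto
    then show ?thesis by (metis diff_add_cancel)
  qed
  ultimately show "(\<forall>x u. (x, u) \<in> H \<longrightarrow> blinfun_apply B (u - \<nu> *\<^sub>C x) = x) \<and>
     (\<forall>y. (blinfun_apply B y, y + \<nu> *\<^sub>C blinfun_apply B y) \<in> H)" by blast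
next
  assume *: "(\<forall>x u. (x, u) \<in> H \<longrightarrow> blinfun_apply B (u - \<nu> *\<^sub>C x) = x) \<and>
     (\<forall>y. (blinfun_apply B y, y + \<nu> *\<^sub>C blinfun_apply B y) \<in> H)"
  show "is_resolvent H \<nu> B"
    unfolding is_resolvent_def
  proof (intro set_eqI iffI)
    fix p assume "p \<in> {(blinfun_apply B y, y) | y. True}"
    then obtain y where "p = (blinfun_apply B y, (y + \<nu> *\<^sub>C blinfun_apply B y) - \<nu> *\<^sub>C blinfun_apply B y)"
      by auto
    with * show "p \<in> {(x, y - \<nu> *\<^sub>C x) | x y. (x, y) \<in> H}" by blast
  qed (use * in force)
qed

lemma closed_adjoint_operator: "closed (adjoint_operator H)"
proof -
  have "adjoint_operator H = (\<Inter>p\<in>H. {q. cinner (fst q) (snd p) = cinner (snd q) (fst p)})"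
    by (force simp: adjoint_operator_def)
  also have "closed \<dots>"
    by (intro closed_INT ballI closed_Collect_eq continuous_intros)
  finally show ?thesis .
qed

context
  fixes H :: "'a::complex_hilbert operator"
  assumes sa: "self_adjoint H"
begin

lemma self_adjoint_closed: "closed H"
  using sa closed_adjoint_operator[of H] by (simp add: self_adjoint_def)

lemma self_adjoint_subspace: "subspace H"
  using sa by (simp add: self_adjoint_def linear_operator_def)

lemma self_adjoint_scaleC: "(x, u) \<in> H \<Longrightarrow> (c *\<^sub>C x, c *\<^sub>C u) \<in> H"
  using sa by (simp add: self_adjoint_def linear_operator_def)

lemma self_adjoint_add: "(x, u) \<in> H \<Longrightarrow> (y, v) \<in> H \<Longrightarrow> (x + y, u + v) \<in> H"
  using subspace_add[OF self_adjoint_subspace, of "(x, u)" "(y, v)"] by simp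

lemma self_adjoint_diff: "(x, u) \<in> H \<Longrightarrow> (y, v) \<in> H \<Longrightarrow> (x - y, u - v) \<in> H"
  using subspace_diff[OF self_adjoint_subspace, of "(x, u)" "(y, v)"] by simp

lemma self_adjoint_scaleR: "(x, u) \<in> H \<Longrightarrow> (r *\<^sub>R x, r *\<^sub>R u) \<in> H"
  using subspace_mul[OF self_adjoint_subspace, of "(x, u)"] by simp

lemma self_adjoint_adjointI: "(\<And>x u. (x, u) \<in> H \<Longrightarrow> cinner y u = cinner z x) \<Longrightarrow> (y, z) \<in> H"
proof -
  assume "\<And>x u. (x, u) \<in> H \<Longrightarrow> cinner y u = cinner z x"
  then have "(y, z) \<in> adjoint_operator H" by (auto simp: adjoint_operator_def)
  then show ?thesis using sa by (simp add: self_adjoint_def)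
qed

lemma self_adjoint_symmetric: "(x, u) \<in> H \<Longrightarrow> (y, v) \<in> H \<Longrightarrow> cinner y u = cinner v x"
proof -
  assume "(x, u) \<in> H" "(y, v) \<in> H"
  moreover have "adjoint_operator H = H" using sa by (simp add: self_adjoint_def)
  ultimately have "(x, u) \<in> H" "(y, v) \<in> adjoint_operator H" by simp_all
  then show ?thesis by (auto simp: adjoint_operator_def)
qed

lemma self_adjoint_cinner_real: "(x, u) \<in> H \<Longrightarrow> Im (cinner x u) = 0"
proof -
  assume "(x, u) \<in> H"
  then have "cinner x u = cnj (cinner x u)"
    using self_adjoint_symmetric cinner_commute by metis
  then have "Im (cinner x u) = Im (cnj (cinner x u))" by (rule arg_cong)
  then show ?thesis by simp
qed

text \<open>The bound at \<open>\<nu>\<close> makes H - \<nu> injective with closed range. A vector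
  orthogonal to the range is an eigenvector of the adjoint, hence of H, for the conjugate of
  \<open>\<nu>\<close>, and the second bound rules this out; so the range is the whole
  space.\<close>

lemma resolvent_exists:
  assumes k: "0 < k"
    and bound: "\<And>x u. (x, u) \<in> H \<Longrightarrow> k * norm x \<le> norm (u - \<nu> *\<^sub>C x)"
    and bound_cnj: "\<And>x u. (x, u) \<in> H \<Longrightarrow> k * norm x \<le> norm (u - cnj \<nu> *\<^sub>C x)"
  obtains B where "is_resolvent H \<nu> B" "norm B \<le> 1 / k"
proof -
  define S where "S = {u - \<nu> *\<^sub>C x | x u. (x, u) \<in> H}"
  have SI: "u - \<nu> *\<^sub>C x \<in> S" if "(x, u) \<in> H" for x u using that by (auto simp: S_def)
  have scal: "c *\<^sub>C v \<in> S" if "v \<in> S" for c v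
  proof -
    from that obtain x u where xu: "v = u - \<nu> *\<^sub>C x" "(x, u) \<in> H" by (auto simp: S_def)
    have "c *\<^sub>C v = c *\<^sub>C u - \<nu> *\<^sub>C c *\<^sub>C x"
      using xu(1) by (simp add: scaleC.diff_right scaleC_scaleC mult.commute)
    with SI[OF self_adjoint_scaleC[OF xu(2), of c]] show ?thesis by simp
  qed
  have sub: "subspace S"
    unfolding subspace_def
  proof (intro conjI ballI allI)
    show "0 \<in> S"
      using SI[of 0 0] subspace_0[OF self_adjoint_subspace] by (simp add: scaleC.zero_right zero_prod_def)
    show "v + w \<in> S" if "v \<in> S" "w \<in> S" for v w
    proof -
      from that obtain x u y t where "v = u - \<nu> *\<^sub>C x" "(x, u) \<in> H" "w = t - \<nu> *\<^sub>C y" "(y, t) \<in> H"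
        by (auto simp: S_def)
      moreover from this have "v + w = (u + t) - \<nu> *\<^sub>C (x + y)" by (simp add: scaleC_add_right)
      ultimately show ?thesis using SI[OF self_adjoint_add] by metis
    qed
    show "r *\<^sub>R v \<in> S" if "v \<in> S" for r v
      using scal[OF that, of "of_real r"] by (simp add: scaleC_of_real)
  qed
  have "closed S"
    unfolding closed_sequential_limits
  proof (intro allI impI)
    fix v l assume *: "(\<forall>n. v n \<in> S) \<and> v \<longlonglongrightarrow> l"
    then have "\<forall>n. \<exists>x u. v n = u - \<nu> *\<^sub>C x \<and> (x, u) \<in> H" by (auto simp: S_def)
    then obtain x u where xu: "\<And>n. v n = u n - \<nu> *\<^sub>C x n" "\<And>n. (x n, u n) \<in> H" by metis
    \<comment> \<open>Applied to differences, the lower bound transfers the Cauchy property from the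
      images back to the preimages; closedness of \<open>H\<close> then identifies the
      limit.\<close>
    have le: "k * dist (x m) (x n) \<le> dist (v m) (v n)" for m n
    proof -
      have "k * norm (x m - x n) \<le> norm ((u m - u n) - \<nu> *\<^sub>C (x m - x n))"
        by (rule bound[OF self_adjoint_diff[OF xu(2) xu(2)]])
      also have "(u m - u n) - \<nu> *\<^sub>C (x m - x n) = v m - v n"
        by (simp add: xu(1) scaleC.diff_right)
      finally show ?thesis by (simp add: dist_norm)
    qed
    have "Cauchy v" using * LIMSEQ_imp_Cauchy by blast
    have "Cauchy x"
    proof (rule metric_CauchyI)
      fix e :: real assume "0 < e"
      then obtain M where M: "\<And>m n. M \<le> m \<Longrightarrow> M \<le> n \<Longrightarrow> dist (v m) (v n) < k * e"
        using metric_CauchyD[OF \<open>Cauchy v\<close>, of "k * e"] k by auto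
      have "dist (x m) (x n) < e" if "M \<le> m" "M \<le> n" for m n
        using le_less_trans[OF le M[OF that]] k by simp
      then show "\<exists>M. \<forall>m\<ge>M. \<forall>n\<ge>M. dist (x m) (x n) < e" by blast
    qed
    then obtain a where a: "x \<longlonglongrightarrow> a" using Cauchy_convergent convergent_def by blast
    have "(\<lambda>n. v n + \<nu> *\<^sub>C x n) \<longlonglongrightarrow> l + \<nu> *\<^sub>C a"
      using * by (intro tendsto_add scaleC.tendsto tendsto_const a) auto
    then have "u \<longlonglongrightarrow> l + \<nu> *\<^sub>C a" by (simp add: xu(1))
    then have "(\<lambda>n. (x n, u n)) \<longlonglongrightarrow> (a, l + \<nu> *\<^sub>C a)" using a by (intro tendsto_Pair)
    then have "(a, l + \<nu> *\<^sub>C a) \<in> H"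
      using closed_sequentially[OF self_adjoint_closed, of "\<lambda>n. (x n, u n)"] xu(2) by blast
    then show "l \<in> S" using SI by force
  qed
  have "S = UNIV"
  proof (rule closed_subspace_eq_UNIV[OF sub \<open>closed S\<close> scal])
    fix w assume w: "\<And>v. v \<in> S \<Longrightarrow> cinner v w = 0"
    have "(w, cnj \<nu> *\<^sub>C w) \<in> H"
    proof (rule self_adjoint_adjointI)
      fix x u assume "(x, u) \<in> H"
      then have "cinner (u - \<nu> *\<^sub>C x) w = 0" by (intro w SI)
      then have "cinner w (u - \<nu> *\<^sub>C x) = 0" by (subst cinner_commute) simp
      then show "cinner w u = cinner (cnj \<nu> *\<^sub>C w) x"
        by (simp add: cinner.diff_right cinner_scaleC_left cinner_scaleC_right)
    qed
    from bound_cnj[OF this] k show "w = 0" by (simp add: mult_le_0_iff)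
  qed
  then have ex: "\<exists>x. (x, y + \<nu> *\<^sub>C x) \<in> H" for y
  proof -
    have "y \<in> S" using \<open>S = UNIV\<close> by simp
    then obtain x u where "y = u - \<nu> *\<^sub>C x" "(x, u) \<in> H" by (auto simp: S_def)
    then have "(x, y + \<nu> *\<^sub>C x) \<in> H" by simp
    then show ?thesis by blast
  qed
  define f where "f y = (SOME x. (x, y + \<nu> *\<^sub>C x) \<in> H)" for y
  have f: "(f y, y + \<nu> *\<^sub>C f y) \<in> H" for y
    unfolding f_def using ex by (rule someI_ex)
  have uniq: "f (u - \<nu> *\<^sub>C x) = x" if xu: "(x, u) \<in> H" for x u
  proof -
    let ?y = "u - \<nu> *\<^sub>C x"
    have "k * norm (f ?y - x) \<le> norm ((?y + \<nu> *\<^sub>C f ?y - u) - \<nu> *\<^sub>C (f ?y - x))"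
      by (rule bound[OF self_adjoint_diff[OF f xu]])
    also have "\<dots> = 0" by (simp add: scaleC.diff_right)
    finally show ?thesis using k by (simp add: mult_le_0_iff)
  qed
  have "bounded_linear f"
  proof (rule bounded_linear_intro[where K = "1 / k"])
    show "f (y + z) = f y + f z" for y z
      using uniq[OF self_adjoint_add[OF f[of y] f[of z]]] by (simp add: scaleC_add_right)
    show "f (r *\<^sub>R y) = r *\<^sub>R f y" for r y
      using uniq[OF self_adjoint_scaleR[OF f[of y], of r]] by (simp add: scaleC.scaleR_right algebra_simps)
    show "norm (f y) \<le> norm y * (1 / k)" for y
      using bound[OF f[of y]] k by (simp add: field_simps)
  qed
  note [simp] = bounded_linear_Blinfun_apply[OF this]
  show thesis
  proof (rule that[of "Blinfun f"])
    show "is_resolvent H \<nu> (Blinfun f)" by (simp add: is_resolvent_iff f uniq)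
    show "norm (Blinfun f) \<le> 1 / k"
    proof (rule norm_blinfun_bound)
      show "norm (blinfun_apply (Blinfun f) y) \<le> 1 / k * norm y" for y
        using bound[OF f[of y]] k by (simp add: field_simps)
    qed (use k in simp)
  qed
qed

text \<open>Since \<open>cinner x u\<close> is real on the graph, the imaginary part of <x, (H -
  \<xi>) x> is exactly - Im \<xi> times the squared norm of \<open>x\<close>. Both \<nu> and its
  conjugate have the same |Im|.\<close>

lemma resolvent_nonreal:
  assumes "Im \<nu> \<noteq> 0"
  shows "is_resolvent H \<nu> (resolvent H \<nu>)" "norm (resolvent H \<nu>) \<le> 1 / \<bar>Im \<nu>\<bar>"
proof -
  have bound: "\<bar>Im \<xi>\<bar> * norm x \<le> norm (u - \<xi> *\<^sub>C x)" if "(x, u) \<in> H" for x u \<xi>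
  proof (cases "x = 0")
    case False
    have "Im (cinner x (u - \<xi> *\<^sub>C x)) = - Im \<xi> * (norm x)\<^sup>2"
      using self_adjoint_cinner_real[OF that]
      by (simp add: cinner.diff_right cinner_scaleC_right cinner_self flip: of_real_power)
    then have "\<bar>Im \<xi>\<bar> * (norm x)\<^sup>2 \<le> norm x * norm (u - \<xi> *\<^sub>C x)"
      using abs_Im_le_cmod[of "cinner x (u - \<xi> *\<^sub>C x)"] cinner_Cauchy_Schwarz[of x "u - \<xi> *\<^sub>C x"]
      by (simp add: abs_mult)
    with False show ?thesis by (simp add: power2_eq_square)
  qed simp
  obtain B where "is_resolvent H \<nu> B" "norm B \<le> 1 / \<bar>Im \<nu>\<bar>"
    using resolvent_exists[of "\<bar>Im \<nu>\<bar>" \<nu>] bound[of _ _ \<nu>] bound[of _ _ "cnj \<nu>"] assms by auto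
  then show "is_resolvent H \<nu> (resolvent H \<nu>)" "norm (resolvent H \<nu>) \<le> 1 / \<bar>Im \<nu>\<bar>"
    using resolvent_eqI by auto
qed

text \<open>The same argument with the real part of <x, (H - \<xi>) x>. It covers points left of
  \<open>m\<close>, including real ones, where the bound through the imaginary part
  degenerates.\<close>

lemma resolvent_left:
  assumes m: "\<And>x u. (x, u) \<in> H \<Longrightarrow> m * (norm x)\<^sup>2 \<le> Re (cinner x u)" and "Re \<nu> < m"
  shows "is_resolvent H \<nu> (resolvent H \<nu>)" "norm (resolvent H \<nu>) \<le> 1 / (m - Re \<nu>)"
proof -
  have bound: "(m - Re \<xi>) * norm x \<le> norm (u - \<xi> *\<^sub>C x)" if "(x, u) \<in> H" for x u \<xi>
  proof (cases "x = 0")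
    case False
    have "Re (cinner x (u - \<xi> *\<^sub>C x)) = Re (cinner x u) - Re \<xi> * (norm x)\<^sup>2"
      by (simp add: cinner.diff_right cinner_scaleC_right cinner_self flip: of_real_power)
    then have "(m - Re \<xi>) * (norm x)\<^sup>2 \<le> norm x * norm (u - \<xi> *\<^sub>C x)"
      using complex_Re_le_cmod[of "cinner x (u - \<xi> *\<^sub>C x)"] cinner_Cauchy_Schwarz[of x "u - \<xi> *\<^sub>C x"]
        m[OF that] by (simp add: algebra_simps)
    with False show ?thesis by (simp add: power2_eq_square)
  qed simp
  obtain B where "is_resolvent H \<nu> B" "norm B \<le> 1 / (m - Re \<nu>)"
    using resolvent_exists[of "m - Re \<nu>" \<nu>] bound[of _ _ \<nu>] bound[of _ _ "cnj \<nu>"] assms(2) by auto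
  then show "is_resolvent H \<nu> (resolvent H \<nu>)" "norm (resolvent H \<nu>) \<le> 1 / (m - Re \<nu>)"
    using resolvent_eqI by auto
qed

end

section \<open>The bottom of the spectrum\<close>

lemma resolvent_off_ray:
  fixes H :: "'a::complex_hilbert operator"
  assumes sa: "self_adjoint H" and \<nu>: "\<nu> \<notin> right_ray (inf_spec H)"
  shows "is_resolvent H \<nu> (resolvent H \<nu>)"
proof (cases "Im \<nu> = 0")
  case True
  then have eq: "\<nu> = complex_of_real (Re \<nu>)" by (simp add: complex_eq_iff)
  have "\<not> inf_spec H \<le> ereal (Re \<nu>)"
  proof
    assume "inf_spec H \<le> ereal (Re \<nu>)"
    then have "complex_of_real (Re \<nu>) \<in> right_ray (inf_spec H)" by (auto simp: right_ray_def)
    with \<nu> eq show False by simp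
  qed
  then have "Re \<nu> \<notin> {x. complex_of_real x \<in> op_spectrum H}"
    unfolding inf_spec_def by (meson INF_lower)
  then have "\<nu> \<in> resolvent_set H" using eq by (simp add: op_spectrum_def)
  then obtain B where "is_resolvent H \<nu> B" by (auto simp: resolvent_set_def)
  then show ?thesis using resolvent_eqI by metis
qed (simp add: resolvent_nonreal[OF sa])

text \<open>If H - l had a bounded inverse B of norm k, its form would be bounded below not merely
  by 0 but by 1 / k, so the optimal bound \<open>l\<close> could be raised. The improvement comes
  from testing the nonnegative form of H - l on x - B x / k, which replaces any use of square roots
  or spectral projections.\<close>

lemma form_bound_in_spectrum:
  fixes H :: "'a::complex_hilbert operator"
  assumes sa: "self_adjoint H" and ne: "(x\<^sub>0, u\<^sub>0) \<in> H" "x\<^sub>0 \<noteq> 0"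
    and l: "\<And>x u. (x, u) \<in> H \<Longrightarrow> l * (norm x)\<^sup>2 \<le> Re (cinner x u)"
    and sharp: "\<And>l'. (\<And>x u. (x, u) \<in> H \<Longrightarrow> l' * (norm x)\<^sup>2 \<le> Re (cinner x u)) \<Longrightarrow> l' \<le> l"
  shows "complex_of_real l \<in> op_spectrum H"
proof (rule ccontr)
  assume "complex_of_real l \<notin> op_spectrum H"
  then obtain B where B: "is_resolvent H (of_real l) B"
    by (auto simp: op_spectrum_def resolvent_set_def)
  note B1 = B[unfolded is_resolvent_iff, THEN conjunct1, rule_format]
  note B2 = B[unfolded is_resolvent_iff, THEN conjunct2, rule_format]
  define k where "k = norm B"
  have "B \<noteq> 0" using B1[OF ne(1)] ne(2) by auto
  then have k: "0 < k" by (simp add: k_def)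
  have "l + 1 / k \<le> l"
  proof (rule sharp)
    fix x u assume xu: "(x, u) \<in> H"
    define w where "w = u - complex_of_real l *\<^sub>C x"
    have Bw: "blinfun_apply B w = x" using B1[OF xu] by (simp add: w_def)
    define b where "b = blinfun_apply B x"
    \<comment> \<open>Here \<open>y\<close> is (H - l) applied to the test vector \<open>z\<close>.
      Expanding <z, y> gives <x, w> - (2 / k) |x|^2 + <b, x> / k^2, and <b, x> \<le> k |x|^2 leaves
      the gain 1 / k.\<close>
    define y where "y = w - (1 / k) *\<^sub>R x"
    define z where "z = x - (1 / k) *\<^sub>R b"
    have Bz: "blinfun_apply B y = z"
      by (simp add: y_def z_def b_def Bw blinfun.diff_right blinfun.scaleR_right)
    have "l * (norm z)\<^sup>2 \<le> Re (cinner z (y + complex_of_real l *\<^sub>C z))"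
      using l[OF B2[of y]] by (simp add: Bz)
    also have "\<dots> = Re (cinner z y) + l * (norm z)\<^sup>2"
      by (simp add: cinner.add_right cinner_scaleC_right cinner_self flip: of_real_power)
    finally have "0 \<le> Re (cinner z y)" by simp
    also have "cinner z y = cinner x w - (1 / k) *\<^sub>R cinner x x - (1 / k) *\<^sub>R cinner b w
        + (1 / k) *\<^sub>R (1 / k) *\<^sub>R cinner b x"
      by (simp add: z_def y_def cinner.diff_left cinner.diff_right cinner.scaleR_left
          cinner.scaleR_right algebra_simps)
    also have "cinner b w = cinner x x"
    proof -
      have "cinner b u = cinner (x + complex_of_real l *\<^sub>C b) x"
        using self_adjoint_symmetric[OF sa xu B2[of x]] by (simp add: b_def)
      then show ?thesis
        by (simp add: w_def cinner.diff_right cinner.add_left cinner_scaleC_left cinner_scaleC_right)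
    qed
    finally have "0 \<le> Re (cinner x w) - 2 / k * (norm x)\<^sup>2 + 1 / k * (1 / k) * Re (cinner b x)"
      by (simp add: Re_cinner_self)
    moreover have "Re (cinner b x) \<le> k * (norm x)\<^sup>2"
    proof -
      have "Re (cinner b x) \<le> norm b * norm x"
        using complex_Re_le_cmod cinner_Cauchy_Schwarz order_trans by blast
      also have "\<dots> \<le> (k * norm x) * norm x"
        unfolding b_def k_def by (intro mult_right_mono norm_blinfun) simp
      finally show ?thesis by (simp add: power2_eq_square mult.assoc)
    qed
    then have "1 / k * (1 / k) * Re (cinner b x) \<le> 1 / k * (1 / k) * (k * (norm x)\<^sup>2)"
      using k by (intro mult_left_mono) auto
    moreover have "1 / k * (1 / k) * (k * (norm x)\<^sup>2) = 1 / k * (norm x)\<^sup>2" "2 / k = 2 * (1 / k)"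
      using k by simp_all
    ultimately have "1 / k * (norm x)\<^sup>2 \<le> Re (cinner x w)"
      by (simp only: mult.assoc)
    moreover have "Re (cinner x w) = Re (cinner x u) - l * (norm x)\<^sup>2"
      by (simp add: w_def cinner.diff_right cinner_scaleC_right cinner_self flip: of_real_power)
    ultimately show "(l + 1 / k) * (norm x)\<^sup>2 \<le> Re (cinner x u)"
      by (simp add: algebra_simps)
  qed
  with k show False by simp
qed

text \<open>On a nonzero space the infimum of the Rayleigh quotients is a point of the spectrum, so
  the spectral infimum is not \<infinity>; \<open>resolvent_left\<close> keeps it above
  \<open>m\<close>. The relation \<open>m \<le> l\<close> is recorded because the ray starts at
  \<open>l\<close> while the norm estimates are expressed through \<open>m\<close>.\<close>

lemma inf_spec_real:
  fixes H :: "'a::complex_hilbert operator" and v :: 'a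
  assumes sa: "self_adjoint H" and m: "\<And>x u. (x, u) \<in> H \<Longrightarrow> m * (norm x)\<^sup>2 \<le> Re (cinner x u)"
    and "v \<noteq> 0"
  obtains l where "inf_spec H = ereal l" "m \<le> l"
proof -
  have "\<not> Domain H \<subseteq> {0}"
  proof
    assume "Domain H \<subseteq> {0}"
    then have "closure (Domain H) \<subseteq> {0}" by (simp add: closure_minimal)
    with sa \<open>v \<noteq> 0\<close> show False by (auto simp: self_adjoint_def)
  qed
  then obtain x0 u0 where ne: "(x0, u0) \<in> H" "x0 \<noteq> 0" by auto
  define Q where "Q = {Re (cinner x u) / (norm x)\<^sup>2 | x u. (x, u) \<in> H \<and> x \<noteq> 0}"
  have Qne: "Q \<noteq> {}" using ne by (auto simp: Q_def)
  have Qm: "m \<le> q" if "q \<in> Q" for q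
    using that m by (auto simp: Q_def field_simps)
  have "complex_of_real (Inf Q) \<in> op_spectrum H"
  proof (rule form_bound_in_spectrum[OF sa ne])
    fix x u assume xu: "(x, u) \<in> H"
    show "Inf Q * (norm x)\<^sup>2 \<le> Re (cinner x u)"
    proof (cases "x = 0")
      case False
      then have "Re (cinner x u) / (norm x)\<^sup>2 \<in> Q" using xu by (auto simp: Q_def)
      then have "Inf Q \<le> Re (cinner x u) / (norm x)\<^sup>2"
        using Qm by (intro cInf_lower bdd_belowI)
      with False show ?thesis by (simp add: field_simps)
    qed (simp add: cinner.zero_left)
  next
    fix l' assume l': "\<And>x u. (x, u) \<in> H \<Longrightarrow> l' * (norm x)\<^sup>2 \<le> Re (cinner x u)"
    show "l' \<le> Inf Q"
      using Qne l' by (intro cInf_greatest) (auto simp: Q_def field_simps)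
  qed
  then have "inf_spec H \<le> ereal (Inf Q)"
    unfolding inf_spec_def by (intro INF_lower) simp
  moreover have "ereal m \<le> inf_spec H"
    unfolding inf_spec_def
  proof (rule INF_greatest)
    fix x :: real assume "x \<in> {x. complex_of_real x \<in> op_spectrum H}"
    then have "\<not> Re (complex_of_real x) < m"
      using resolvent_left(1)[OF sa m, of "of_real x"] by (auto simp: op_spectrum_def resolvent_set_def)
    then show "ereal m \<le> ereal x" by simp
  qed
  ultimately show thesis
    using that by (cases "inf_spec H") auto
qed

section \<open>The resolvent identity and holomorphy\<close>

definition clinear_blinfun :: "('a::complex_inner \<Rightarrow>\<^sub>L 'b::complex_inner) \<Rightarrow> bool" where
  "clinear_blinfun A \<longleftrightarrow> (\<forall>c x. blinfun_apply A (c *\<^sub>C x) = c *\<^sub>C blinfun_apply A x)"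

text \<open>Complex linearity and the first resolvent identity, detached from any generator. In this
  form they pass directly to R(z) \<otimes> Id, without introducing H \<otimes> Id as an unbounded
  operator.\<close>

definition pseudo_resolvent :: "complex set \<Rightarrow> (complex \<Rightarrow> 'a::complex_inner \<Rightarrow>\<^sub>L 'a) \<Rightarrow> bool" where
  "pseudo_resolvent U R \<longleftrightarrow> (\<forall>z\<in>U. clinear_blinfun (R z)) \<and>
     (\<forall>z\<in>U. \<forall>w\<in>U. \<forall>x. R z x - R w x = (z - w) *\<^sub>C R z (R w x))"

text \<open>The identity results from applying R(z) to (H - z) R(w) y = y + (w - z) R(w) y.\<close>

lemma pseudo_resolvent_resolvent:
  fixes H :: "'a::complex_hilbert operator" and R :: "complex \<Rightarrow> 'a \<Rightarrow>\<^sub>L 'a"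
  assumes sa: "self_adjoint H" and res: "\<And>z. z \<in> U \<Longrightarrow> is_resolvent H z (R z)"
  shows "pseudo_resolvent U R"
proof -
  have 1: "R z (u - z *\<^sub>C x) = x" if "z \<in> U" "(x, u) \<in> H" for x u z
    using res[OF that(1)] that(2) by (auto simp: is_resolvent_iff)
  have 2: "(R z y, y + z *\<^sub>C R z y) \<in> H" if "z \<in> U" for y z
    using res[OF that(1)] by (auto simp: is_resolvent_iff)
  have C: "R z (c *\<^sub>C y) = c *\<^sub>C R z y" if z: "z \<in> U" for z c y
    using 1[OF z self_adjoint_scaleC[OF sa 2[OF z, of y], of c]]
    by (simp add: scaleC_add_right scaleC_scaleC mult.commute)
  have "R z y - R w y = (z - w) *\<^sub>C R z (R w y)" if z: "z \<in> U" and w: "w \<in> U" for z w y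
    using 1[OF z 2[OF w, of y]]
    by (simp add: blinfun.diff_right blinfun.add_right C[OF z] scaleC.diff_left algebra_simps)
  with C show ?thesis by (auto simp: pseudo_resolvent_def clinear_blinfun_def)
qed

text \<open>Together the two parts say that H and its resolvent commute on the domain, the common
  value being x + z R(z) x.\<close>

lemma resolvent_apply_domain:
  fixes H :: "'a::complex_hilbert operator"
  assumes sa: "self_adjoint H" and z: "z \<notin> right_ray (inf_spec H)"
  shows "(x, u) \<in> H \<Longrightarrow> resolvent H z u = x + z *\<^sub>C resolvent H z x"
    and "(resolvent H z x, x + z *\<^sub>C resolvent H z x) \<in> H"
proof -
  have res: "is_resolvent H w (resolvent H w)" if "w \<in> {z}" for w
    using resolvent_off_ray[OF sa z] that by simp
  have "resolvent H z (z *\<^sub>C x) = z *\<^sub>C resolvent H z x"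
    using pseudo_resolvent_resolvent[OF sa res] unfolding pseudo_resolvent_def clinear_blinfun_def by blast
  then show "(x, u) \<in> H \<Longrightarrow> resolvent H z u = x + z *\<^sub>C resolvent H z x"
    and "(resolvent H z x, x + z *\<^sub>C resolvent H z x) \<in> H"
    using resolvent_off_ray[OF sa z] by (auto simp: is_resolvent_iff blinfun.diff_right algebra_simps)
qed

text \<open>The resolvent identity bounds the difference by |z - w| times the product of the two
  norms. No local bound on \<open>norm (R z)\<close> is assumed; it follows by absorbing that norm
  into the left side once |z - w| \<open>k\<close> is at most 1/2.\<close>

lemma pseudo_resolvent_continuous_on:
  fixes R :: "complex \<Rightarrow> 'a::complex_inner \<Rightarrow>\<^sub>L 'a"
  assumes "pseudo_resolvent U R"
  shows "continuous_on U R"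
  unfolding continuous_on_iff
proof (intro ballI allI impI)
  fix w and e :: real assume w: "w \<in> U" and e: "0 < e"
  define k where "k = norm (R w)"
  have k: "0 \<le> k" by (simp add: k_def)
  have le: "norm (R z - R w) \<le> norm (z - w) * (norm (R z) * k)" if z: "z \<in> U" for z
  proof (rule norm_blinfun_bound)
    fix x
    have "norm ((R z - R w) x) = norm (z - w) * norm (R z (R w x))"
      using assms z w by (simp add: pseudo_resolvent_def blinfun.diff_left norm_scaleC)
    also have "norm (R z (R w x)) \<le> norm (R z) * (k * norm x)"
      unfolding k_def by (rule order_trans[OF norm_blinfun mult_left_mono[OF norm_blinfun]]) simp
    finally show "norm ((R z - R w) x) \<le> norm (z - w) * (norm (R z) * k) * norm x"
      by (simp add: mult_left_mono mult.assoc)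
  qed (simp add: k)
  \<comment> \<open>The first entry yields \<open>norm (R z) \<le> 2 * k\<close>, the second makes
    |z - w| 2 k^2 smaller than \<open>e\<close>. The summands 1 keep the denominators positive when
    \<open>k\<close> is 0.\<close>
  define d where "d = min (1 / (2 * k + 1)) (e / (2 * k\<^sup>2 + 1))"
  have d: "0 < d" using k e by (simp add: d_def add_nonneg_pos)
  have "dist (R z) (R w) < e" if z: "z \<in> U" "dist z w < d" for z
  proof -
    let ?t = "norm (z - w)"
    have "?t < 1 / (2 * k + 1)" "?t < e / (2 * k\<^sup>2 + 1)"
      using z(2) by (simp_all add: d_def dist_norm)
    moreover have "0 < 2 * k + 1" "0 < 2 * k\<^sup>2 + 1"
      using k by (simp_all add: add_nonneg_pos)
    ultimately have t: "?t * (2 * k + 1) < 1" "?t * (2 * k\<^sup>2 + 1) < e"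
      by (simp_all only: pos_less_divide_eq)
    have "?t * (2 * k + 1) = ?t + 2 * (?t * k)" by (simp add: algebra_simps)
    with t(1) norm_ge_zero[of "z - w"] have "2 * (?t * k) \<le> 1" by linarith
    then have "2 * (?t * k) * norm (R z) \<le> 1 * norm (R z)" by (intro mult_right_mono) auto
    moreover have "norm (R z) \<le> norm (R z - R w) + k"
      unfolding k_def by (metis add.commute norm_triangle_sub)
    ultimately have "norm (R z) \<le> 2 * k" using le[OF z(1)] by (simp add: algebra_simps)
    then have "?t * (norm (R z) * k) \<le> ?t * (2 * k * k)"
      using k by (intro mult_left_mono mult_right_mono) auto
    also have "\<dots> \<le> ?t * (2 * k\<^sup>2 + 1)"
      by (intro mult_left_mono) (auto simp: power2_eq_square)
    finally show ?thesis using le[OF z(1)] t(2) unfolding dist_norm by linarith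
  qed
  with d show "\<exists>d>0. \<forall>z\<in>U. dist z w < d \<longrightarrow> dist (R z) (R w) < e" by blast
qed

text \<open>Caratheodory's form of differentiability, suited to resolvent identities, which supply
  the difference quotient explicitly.\<close>

lemma has_field_derivative_quotient:
  fixes f :: "complex \<Rightarrow> complex"
  assumes "open U" "w \<in> U" and eq: "\<And>z. z \<in> U \<Longrightarrow> f z - f w = (z - w) * q z"
    and q: "continuous_on U q"
  shows "(f has_field_derivative q w) (at w)"
proof -
  have "(q \<longlongrightarrow> q w) (at w)"
    using assms continuous_on_eq_continuous_at isCont_def by blast
  moreover have "\<forall>\<^sub>F z in at w. q z = (f z - f w) / (z - w)"
    using eventually_at_in_open[OF assms(1,2)] by eventually_elim (simp add: eq)
  ultimately show ?thesis
    unfolding has_field_derivative_iff by (rule Lim_transform_eventually)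
qed

lemma pseudo_resolvent_holomorphic:
  fixes \<phi> :: "'a::complex_inner \<Rightarrow> complex"
  assumes R: "pseudo_resolvent U R" and U: "open U"
    and \<phi>: "bounded_linear \<phi>" "\<And>c x. \<phi> (c *\<^sub>C x) = c * \<phi> x"
  shows "(\<lambda>z. \<phi> (R z x)) holomorphic_on U"
  unfolding holomorphic_on_open[OF U]
proof
  fix w assume w: "w \<in> U"
  have "((\<lambda>z. \<phi> (R z x)) has_field_derivative \<phi> (R w (R w x))) (at w)"
  proof (rule has_field_derivative_quotient[OF U w, where q = "\<lambda>z. \<phi> (R z (R w x))"])
    show "\<phi> (R z x) - \<phi> (R w x) = (z - w) * \<phi> (R z (R w x))" if "z \<in> U" for z
      using R w that \<phi> by (simp add: pseudo_resolvent_def flip: linear_diff[OF bounded_linear.linear[OF \<phi>(1)]])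
    show "continuous_on U (\<lambda>z. \<phi> (R z (R w x)))"
      by (intro bounded_linear.continuous_on[OF \<phi>(1)] blinfun.continuous_on
          pseudo_resolvent_continuous_on R continuous_on_const)
  qed
  then show "\<exists>f'. ((\<lambda>z. \<phi> (R z x)) has_field_derivative f') (at w)" ..
qed

lemma pseudo_resolvent_product_holomorphic:
  fixes P Q :: "complex \<Rightarrow> 'c::complex_inner \<Rightarrow>\<^sub>L 'c"
  assumes P: "pseudo_resolvent U\<^sub>1 P" and Q: "pseudo_resolvent U\<^sub>2 Q"
    and U: "open U" "U \<subseteq> U\<^sub>1" "(\<lambda>z. \<mu> - z) ` U \<subseteq> U\<^sub>2"
  shows "continuous_on U (\<lambda>z. P z o\<^sub>L Q (\<mu> - z))"
    and "(\<lambda>z. cinner \<xi> ((P z o\<^sub>L Q (\<mu> - z)) \<eta>)) holomorphic_on U"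
proof -
  have contP: "continuous_on U P"
    using pseudo_resolvent_continuous_on[OF P] U(2) continuous_on_subset by blast
  have contQ: "continuous_on U (\<lambda>z. Q (\<mu> - z))"
    by (rule continuous_on_compose2[OF pseudo_resolvent_continuous_on[OF Q] _ U(3)])
      (intro continuous_intros)
  show "continuous_on U (\<lambda>z. P z o\<^sub>L Q (\<mu> - z))"
    by (intro bounded_bilinear.continuous_on[OF bounded_bilinear_blinfun_compose] contP contQ)
  show "(\<lambda>z. cinner \<xi> ((P z o\<^sub>L Q (\<mu> - z)) \<eta>)) holomorphic_on U"
    unfolding holomorphic_on_open[OF U(1)]
  proof
    fix w assume w: "w \<in> U"
    \<comment> \<open>The difference quotient obtained by changing one factor at a time. At
      \<open>z = w\<close> it is the product rule, with a minus sign from the argument \<mu> - z.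
      The order of the factors is kept, so \<open>P\<close> and \<open>Q\<close> need not
      commute.\<close>
    let ?q = "\<lambda>z. cinner \<xi> (P z (P w (Q (\<mu> - z) \<eta>)) - P w (Q (\<mu> - z) (Q (\<mu> - w) \<eta>)))"
    have "((\<lambda>z. cinner \<xi> ((P z o\<^sub>L Q (\<mu> - z)) \<eta>)) has_field_derivative ?q w) (at w)"
    proof (rule has_field_derivative_quotient[OF U(1) w, where q = ?q])
      fix z assume z: "z \<in> U"
      have in1: "z \<in> U\<^sub>1" "w \<in> U\<^sub>1" and in2: "\<mu> - z \<in> U\<^sub>2" "\<mu> - w \<in> U\<^sub>2" using z w U by auto
      have "P z (Q (\<mu> - z) \<eta>) - P w (Q (\<mu> - w) \<eta>)
          = (P z (Q (\<mu> - z) \<eta>) - P w (Q (\<mu> - z) \<eta>)) + P w (Q (\<mu> - z) \<eta> - Q (\<mu> - w) \<eta>)"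
        by (simp add: blinfun.diff_right)
      also have "\<dots> = (z - w) *\<^sub>C P z (P w (Q (\<mu> - z) \<eta>))
          + P w ((w - z) *\<^sub>C Q (\<mu> - z) (Q (\<mu> - w) \<eta>))"
        using P Q in1 in2 by (simp add: pseudo_resolvent_def)
      also have "\<dots> = (z - w) *\<^sub>C (P z (P w (Q (\<mu> - z) \<eta>)) - P w (Q (\<mu> - z) (Q (\<mu> - w) \<eta>)))"
      proof -
        have "P w (c *\<^sub>C x) = c *\<^sub>C P w x" for c x
          using P in1 by (simp add: pseudo_resolvent_def clinear_blinfun_def)
        then show ?thesis
          by (simp add: scaleC.diff_right) (simp add: scaleC.diff_left)
      qed
      finally show "cinner \<xi> ((P z o\<^sub>L Q (\<mu> - z)) \<eta>) - cinner \<xi> ((P w o\<^sub>L Q (\<mu> - w)) \<eta>) = (z - w) * ?q z"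
        by (simp flip: cinner.diff_right cinner_scaleC_right)
    next
      show "continuous_on U ?q"
        by (intro cinner.continuous_on blinfun.continuous_on continuous_on_diff contP contQ continuous_on_const)
    qed
    then show "\<exists>f'. ((\<lambda>z. cinner \<xi> ((P z o\<^sub>L Q (\<mu> - z)) \<eta>)) has_field_derivative f') (at w)" ..
  qed
qed

section \<open>Operators acting on one tensor factor\<close>

lemma bounded_bilinear_tensor:
  assumes "hilbert_tensor_product tensor"
  shows "bounded_bilinear tensor"
proof
  note T = assms[unfolded hilbert_tensor_product_def]
  show "tensor (x + x') y = tensor x y + tensor x' y" for x x' y using T by blast
  show "tensor x (y + y') = tensor x y + tensor x y'" for x y y' using T by blast
  show "tensor (r *\<^sub>R x) y = r *\<^sub>R tensor x y" "tensor x (r *\<^sub>R y) = r *\<^sub>R tensor x y" for r x y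
    using T by (simp_all flip: scaleC_of_real)
  have "norm (tensor x y) = norm x * norm y" for x y
  proof -
    have "cinner (tensor x y) (tensor x y) = cinner x x * cinner y y" using T by blast
    then have "(norm (tensor x y))\<^sup>2 = (norm x * norm y)\<^sup>2"
      by (simp only: cinner_self power_mult_distrib flip: of_real_mult) (simp only: of_real_eq_iff)
    then show ?thesis by (simp add: power2_eq_iff_nonneg)
  qed
  then show "\<exists>K. \<forall>x y. norm (tensor x y) \<le> norm x * norm y * K"
    by (intro exI[of _ 1]) simp
qed

text \<open>Lets everything proved about operators on the first factor be reused for the
  second.\<close>

lemma hilbert_tensor_product_flip:
  assumes "hilbert_tensor_product tensor"
  shows "hilbert_tensor_product (\<lambda>y x. tensor x y)"
proof -
  have "{tensor x y | y x. True} = {tensor x y | x y. True}" by blast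
  with assms show ?thesis
    by (simp add: hilbert_tensor_product_def mult.commute)
qed

lemma bounded_linear_eq_on_tensors:
  assumes tensor: "hilbert_tensor_product tensor"
    and f: "bounded_linear f" and g: "bounded_linear g"
    and eq: "\<And>x y. f (tensor x y) = g (tensor x y)"
  shows "f z = g z"
proof -
  let ?S = "span {tensor x y | x y. True}"
  have "closed {z. f z = g z}"
    by (intro closed_Collect_eq linear_continuous_on f g)
  moreover have "?S \<subseteq> {z. f z = g z}"
    using linear_eq_on[OF bounded_linear.linear[OF f] bounded_linear.linear[OF g]] eq by blast
  ultimately have "closure ?S \<subseteq> {z. f z = g z}" by (rule closure_minimal[rotated])
  with tensor show ?thesis by (auto simp: hilbert_tensor_product_def)
qed

lemma subspace_closure:
  fixes S :: "'a::real_normed_vector set"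
  assumes S: "subspace S"
  shows "subspace (closure S)"
  unfolding subspace_def
proof (intro conjI ballI allI)
  show "0 \<in> closure S" using subspace_0[OF S] closure_subset by blast
  fix x assume "x \<in> closure S"
  then obtain a where a: "\<And>n. a n \<in> S" "a \<longlonglongrightarrow> x" unfolding closure_sequential by blast
  show "x + y \<in> closure S" if "y \<in> closure S" for y
  proof -
    from that obtain b where b: "\<And>n. b n \<in> S" "b \<longlonglongrightarrow> y" unfolding closure_sequential by blast
    show ?thesis unfolding closure_sequential
      by (rule exI[of _ "\<lambda>n. a n + b n"]) (use a b S in \<open>auto intro: subspace_add tendsto_add\<close>)
  qed
  show "c *\<^sub>R x \<in> closure S" for c
    unfolding closure_sequential
    by (rule exI[of _ "\<lambda>n. c *\<^sub>R a n"]) (use a S in \<open>auto intro: subspace_mul tendsto_scaleR\<close>)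
qed

text \<open>Extends a densely defined operator given only as a relation. The bound on
  \<open>K\<close> supplies single-valuedness, so an operator on algebraic tensors can be described
  by its pairs without first proving independence of the representation.\<close>

lemma closed_graph_blinfun:
  fixes K :: "('a::banach \<times> 'b::banach) set"
  assumes K: "subspace K" "closed K" and C: "0 \<le> C" "\<And>p. p \<in> K \<Longrightarrow> norm (snd p) \<le> C * norm (fst p)"
    and dense: "closure (fst ` K) = UNIV"
  obtains B where "\<And>z w. (z, w) \<in> K \<Longrightarrow> blinfun_apply B z = w" "norm B \<le> C"
proof -
  have ex: "\<exists>w. (z, w) \<in> K" for z
  proof -
    have "z \<in> closure (fst ` K)" using dense by simp
    then obtain v where v: "\<And>n. v n \<in> fst ` K" "v \<longlonglongrightarrow> z"
      unfolding closure_sequential by blast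
    then have "\<forall>n. \<exists>w. (v n, w) \<in> K" by force
    then obtain w where w: "\<And>n. (v n, w n) \<in> K" by metis
    have le: "dist (w m) (w n) \<le> C * dist (v m) (v n)" for m n
      using C(2)[OF subspace_diff[OF K(1) w w], of m n] by (simp add: dist_norm)
    have "Cauchy v" using v(2) by (rule LIMSEQ_imp_Cauchy)
    have "Cauchy w"
    proof (rule metric_CauchyI)
      fix e :: real assume "0 < e"
      \<comment> \<open>Division by \<open>C + 1\<close> rather than \<open>C\<close> covers the
        case where \<open>C\<close> is 0.\<close>
      then obtain M where M: "\<And>m n. M \<le> m \<Longrightarrow> M \<le> n \<Longrightarrow> dist (v m) (v n) < e / (C + 1)"
        using metric_CauchyD[OF \<open>Cauchy v\<close>, of "e / (C + 1)"] C(1) by auto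
      have "dist (w m) (w n) < e" if "M \<le> m" "M \<le> n" for m n
      proof -
        have "dist (w m) (w n) \<le> (C + 1) * dist (v m) (v n)"
          by (rule order_trans[OF le]) (simp add: mult_right_mono)
        also have "\<dots> < e" using M[OF that] C(1) by (simp add: field_simps)
        finally show ?thesis .
      qed
      then show "\<exists>M. \<forall>m\<ge>M. \<forall>n\<ge>M. dist (w m) (w n) < e" by blast
    qed
    then obtain l where "w \<longlonglongrightarrow> l" using Cauchy_convergent convergent_def by blast
    then have "(\<lambda>n. (v n, w n)) \<longlonglongrightarrow> (z, l)" using v(2) by (intro tendsto_Pair)
    then have "(z, l) \<in> K"
      using closed_sequentially[OF K(2), of "\<lambda>n. (v n, w n)"] w by blast
    then show ?thesis ..
  qed
  define f where "f z = (SOME w. (z, w) \<in> K)" for z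
  have f: "(z, f z) \<in> K" for z unfolding f_def using ex by (rule someI_ex)
  have uniq: "f z = w" if "(z, w) \<in> K" for z w
    using C(2)[OF subspace_diff[OF K(1) f[of z] that]] by simp
  have bl: "bounded_linear f"
  proof (rule bounded_linear_intro[where K = C])
    show "f (y + z) = f y + f z" for y z
      using uniq[of "y + z" "f y + f z"] subspace_add[OF K(1) f[of y] f[of z]] by simp
    show "f (r *\<^sub>R y) = r *\<^sub>R f y" for r y
      using uniq[of "r *\<^sub>R y" "r *\<^sub>R f y"] subspace_mul[OF K(1) f[of y]] by simp
    show "norm (f y) \<le> norm y * C" for y
      using C(2)[OF f[of y]] by (simp add: mult.commute)
  qed
  show thesis
  proof (rule that[of "Blinfun f"])
    show "blinfun_apply (Blinfun f) z = w" if "(z, w) \<in> K" for z w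
      using uniq[OF that] bl by (simp add: bounded_linear_Blinfun_apply)
    show "norm (Blinfun f) \<le> C"
      using C(1) C(2)[OF f] bl by (intro norm_blinfun_bound) (auto simp: bounded_linear_Blinfun_apply)
  qed
qed

context
  fixes tensor :: "'a::complex_hilbert \<Rightarrow> 'b::complex_hilbert \<Rightarrow> 'c::complex_hilbert"
  assumes tensor: "hilbert_tensor_product tensor"
begin

interpretation tensor: bounded_bilinear tensor
  by (rule bounded_bilinear_tensor[OF tensor])

lemma tensor_scaleC_left: "tensor (c *\<^sub>C x) y = c *\<^sub>C tensor x y"
  and tensor_scaleC_right: "tensor x (c *\<^sub>C y) = c *\<^sub>C tensor x y"
  and cinner_tensor: "cinner (tensor x y) (tensor x' y') = cinner x x' * cinner y y'"
  and tensor_dense: "closure (span {tensor x y | x y. True}) = UNIV"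
  using tensor unfolding hilbert_tensor_product_def by blast+

text \<open>Orthogonality in the second factor alone removes all cross terms; the vectors
  \<open>X i\<close> are arbitrary, so the formula survives applying an operator to them.\<close>

lemma norm_sum_orthogonal_tensors:
  fixes n :: nat
  assumes "\<And>i j. i < n \<Longrightarrow> j < n \<Longrightarrow> i \<noteq> j \<Longrightarrow> cinner (e i) (e j) = 0"
  shows "(norm (\<Sum>i<n. tensor (X i) (e i)))\<^sup>2 = (\<Sum>i<n. (norm (X i))\<^sup>2 * (norm (e i))\<^sup>2)"
proof -
  have "cinner (\<Sum>i<n. tensor (X i) (e i)) (\<Sum>i<n. tensor (X i) (e i))
      = (\<Sum>i<n. \<Sum>j<n. cinner (X i) (X j) * cinner (e i) (e j))"
    by (simp add: cinner.sum_left cinner.sum_right cinner_tensor) (rule sum.swap)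
  also have "\<dots> = (\<Sum>i<n. \<Sum>j<n. if i = j then cinner (X i) (X i) * cinner (e i) (e i) else 0)"
    using assms by (intro sum.cong) auto
  also have "\<dots> = (\<Sum>i<n. cinner (X i) (X i) * cinner (e i) (e i))"
    by (intro sum.cong) simp_all
  also have "\<dots> = complex_of_real (\<Sum>i<n. (norm (X i))\<^sup>2 * (norm (e i))\<^sup>2)"
    by (simp add: cinner_self)
  finally show ?thesis
    unfolding cinner_self of_real_eq_iff .
qed

text \<open>Gram--Schmidt in the second factor. The vectors \<open>e i\<close> are allowed to vanish; division
  by the squared norm is then division by zero and contributes nothing.\<close>

lemma span_tensor_orthogonal:
  fixes A :: "'a \<Rightarrow>\<^sub>L 'a"
  assumes A: "clinear_blinfun A" and p: "p \<in> span {(tensor x y, tensor (A x) y) | x y. True}"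
  obtains n e X where "\<And>i j. i < n \<Longrightarrow> j < n \<Longrightarrow> i \<noteq> j \<Longrightarrow> cinner (e i) (e j) = 0"
    and "p = (\<Sum>i<(n::nat). (tensor (X i) (e i), tensor (A (X i)) (e i)))"
proof -
  define good where "good p \<longleftrightarrow> (\<exists>n e X. (\<forall>i<n. \<forall>j<n. i \<noteq> j \<longrightarrow> cinner (e i) (e j) = 0) \<and>
      p = (\<Sum>i<(n::nat). (tensor (X i) (e i), tensor (A (X i)) (e i))))" for p
  have "good p"
    using p
  proof (induction rule: span_induct_alt)
    case base
    show ?case unfolding good_def by (rule exI[of _ 0]) auto
  next
    case (step c s q)
    from step.hyps obtain x0 y where s: "s = (tensor x0 y, tensor (A x0) y)" by blast
    define x where "x = c *\<^sub>R x0"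
    have cs: "c *\<^sub>R s = (tensor x y, tensor (A x) y)"
      by (simp add: s x_def tensor.scaleR_left blinfun.scaleR_right)
    from step.IH obtain n e X where orth: "\<And>i j. i < n \<Longrightarrow> j < n \<Longrightarrow> i \<noteq> j \<Longrightarrow> cinner (e i) (e j) = 0"
      and q: "q = (\<Sum>i<(n::nat). (tensor (X i) (e i), tensor (A (X i)) (e i)))"
      unfolding good_def by blast
    define a where "a i = cinner (e i) y / complex_of_real ((norm (e i))\<^sup>2)" for i
    define y' where "y' = y - (\<Sum>i<n. a i *\<^sub>C e i)"
    have y: "y = (\<Sum>i<n. a i *\<^sub>C e i) + y'" by (simp add: y'_def)
    have y'0: "cinner (e j) y' = 0" if j: "j < n" for j
    proof -
      have "cinner (e j) (\<Sum>i<n. a i *\<^sub>C e i) = (\<Sum>i<n. if i = j then a j * cinner (e j) (e j) else 0)"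
        unfolding cinner.sum_right cinner_scaleC_right using orth j by (intro sum.cong) auto
      also have "\<dots> = a j * cinner (e j) (e j)" using j by simp
      also have "\<dots> = cinner (e j) y"
        by (cases "e j = 0") (simp_all add: a_def cinner_self cinner.zero_left)
      finally show ?thesis by (simp add: y'_def cinner.diff_right)
    qed
    then have y'0': "cinner y' (e j) = 0" if "j < n" for j
      using that by (subst cinner_commute) simp
    define e' where "e' = e(n := y')"
    \<comment> \<open>The components of \<open>y\<close> along the old \<open>e i\<close> are moved
      into the first factors, and the orthogonal remainder \<open>y'\<close> becomes the new last
      vector with first factor \<open>x\<close>.\<close>
    define X' where "X' = (\<lambda>i. X i + a i *\<^sub>C x)(n := x)"
    have split: "tensor (D x) y = (\<Sum>i<n. tensor (a i *\<^sub>C D x) (e i)) + tensor (D x) y'" for D :: "'a \<Rightarrow> 'a"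
      by (subst y) (simp add: tensor.add_right tensor.sum_right tensor_scaleC_left tensor_scaleC_right)
    have "c *\<^sub>R s + q = (\<Sum>i<Suc n. (tensor (X' i) (e' i), tensor (A (X' i)) (e' i)))"
    proof (rule prod_eqI)
      have "(\<Sum>i<n. tensor (X' i) (e' i)) = (\<Sum>i<n. tensor (X i) (e i)) + (\<Sum>i<n. tensor (a i *\<^sub>C x) (e i))"
        unfolding sum.distrib[symmetric] by (rule sum.cong) (auto simp: X'_def e'_def tensor.add_left)
      then show "fst (c *\<^sub>R s + q) = fst (\<Sum>i<Suc n. (tensor (X' i) (e' i), tensor (A (X' i)) (e' i)))"
        using split[of "\<lambda>x. x"] by (simp add: cs q fst_sum) (simp add: X'_def e'_def)
      have "(\<Sum>i<n. tensor (A (X' i)) (e' i)) = (\<Sum>i<n. tensor (A (X i)) (e i)) + (\<Sum>i<n. tensor (a i *\<^sub>C A x) (e i))"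
        unfolding sum.distrib[symmetric] using A
        by (intro sum.cong) (auto simp: X'_def e'_def tensor.add_left blinfun.add_right clinear_blinfun_def)
      then show "snd (c *\<^sub>R s + q) = snd (\<Sum>i<Suc n. (tensor (X' i) (e' i), tensor (A (X' i)) (e' i)))"
        using split[of "blinfun_apply A"] by (simp add: cs q snd_sum) (simp add: X'_def e'_def)
    qed
    moreover have "cinner (e' i) (e' j) = 0" if "i < Suc n" "j < Suc n" "i \<noteq> j" for i j
      using that orth y'0 y'0' by (auto simp: e'_def less_Suc_eq)
    ultimately show ?case unfolding good_def by blast
  qed
  then show thesis unfolding good_def using that by blast
qed

text \<open>After orthogonalizing the second factors, A \<otimes> Id acts separately on orthogonal
  summands, each of which grows by at most \<open>norm A\<close>. Hence the bound holds on the span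
  of the pairs, and on its closure \<open>K\<close>.\<close>

lemma tensor_left_exists:
  fixes A :: "'a \<Rightarrow>\<^sub>L 'a"
  assumes A: "clinear_blinfun A"
  obtains L where "\<And>x y. blinfun_apply L (tensor x y) = tensor (A x) y"
    "norm L \<le> norm A" "clinear_blinfun L"
proof -
  let ?G = "{(tensor x y, tensor (A x) y) | x y. True}"
  define K where "K = closure (span ?G)"
  have sub: "subspace K" unfolding K_def by (intro subspace_closure subspace_span)
  have "norm (snd p) \<le> norm A * norm (fst p)" if pG: "p \<in> span ?G" for p
  proof -
    obtain n e X where orth: "\<And>i j. i < n \<Longrightarrow> j < n \<Longrightarrow> i \<noteq> j \<Longrightarrow> cinner (e i) (e j) = 0"
      and p: "p = (\<Sum>i<(n::nat). (tensor (X i) (e i), tensor (A (X i)) (e i)))"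
      by (rule span_tensor_orthogonal[OF A pG]) blast
    have "(norm (snd p))\<^sup>2 = (\<Sum>i<n. (norm (A (X i)))\<^sup>2 * (norm (e i))\<^sup>2)"
      unfolding p snd_sum by (simp add: norm_sum_orthogonal_tensors[OF orth])
    also have "\<dots> \<le> (\<Sum>i<n. (norm A * norm (X i))\<^sup>2 * (norm (e i))\<^sup>2)"
      by (intro sum_mono mult_right_mono power_mono norm_blinfun) auto
    also have "\<dots> = (norm A)\<^sup>2 * (norm (fst p))\<^sup>2"
      unfolding p fst_sum
      by (simp add: norm_sum_orthogonal_tensors[OF orth] power_mult_distrib sum_distrib_left mult.assoc)
    finally have "(norm (snd p))\<^sup>2 \<le> (norm A * norm (fst p))\<^sup>2"
      by (simp add: power_mult_distrib)
    then show ?thesis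
      by (rule power2_le_imp_le) simp
  qed
  then have "span ?G \<subseteq> {p. norm (snd p) \<le> norm A * norm (fst p)}" by blast
  then have bound: "K \<subseteq> {p. norm (snd p) \<le> norm A * norm (fst p)}"
    unfolding K_def by (rule closure_minimal) (intro closed_Collect_le continuous_intros)
  have G: "(tensor x y, tensor (A x) y) \<in> span ?G" for x y
    by (rule span_base) blast
  have "{tensor x y | x y. True} \<subseteq> fst ` span ?G"
  proof clarify
    show "tensor x y \<in> fst ` span ?G" for x y
      by (rule image_eqI[OF _ G]) simp
  qed
  then have "span {tensor x y | x y. True} \<subseteq> fst ` span ?G"
    by (intro span_minimal linear_subspace_image linear_fst subspace_span)
  also have "\<dots> \<subseteq> fst ` K"
    unfolding K_def by (intro image_mono closure_subset)
  finally have "closure (span {tensor x y | x y. True}) \<subseteq> closure (fst ` K)"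
    by (rule closure_mono)
  then have dense: "closure (fst ` K) = UNIV"
    unfolding tensor_dense by blast
  have clK: "closed K" by (simp add: K_def)
  obtain L where L: "\<And>z w. (z, w) \<in> K \<Longrightarrow> blinfun_apply L z = w" and nL: "norm L \<le> norm A"
    by (rule closed_graph_blinfun[OF sub clK norm_ge_zero[of A] _ dense]) (use bound in blast)+
  have LT: "blinfun_apply L (tensor x y) = tensor (A x) y" for x y
    by (rule L) (unfold K_def, rule closure_subset[THEN subsetD], rule G)
  have "clinear_blinfun L"
    unfolding clinear_blinfun_def
  proof (intro allI)
    fix c z
    show "L (c *\<^sub>C z) = c *\<^sub>C L z"
    proof (rule bounded_linear_eq_on_tensors[OF tensor, where f = "\<lambda>z. L (c *\<^sub>C z)"])
      show "L (c *\<^sub>C tensor x y) = c *\<^sub>C L (tensor x y)" for x y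
        using LT[of "c *\<^sub>C x" y] A by (simp add: LT tensor_scaleC_left clinear_blinfun_def)
      show "bounded_linear (\<lambda>z. L (c *\<^sub>C z))"
        by (rule bounded_linear_compose[OF blinfun.bounded_linear_right bounded_linear_scaleC])
      show "bounded_linear (\<lambda>z. c *\<^sub>C L z)"
        by (rule bounded_linear_compose[OF bounded_linear_scaleC blinfun.bounded_linear_right])
    qed
  qed
  with LT nL show thesis by (rule that)
qed

lemma pseudo_resolvent_tensor_left:
  fixes R :: "complex \<Rightarrow> 'a \<Rightarrow>\<^sub>L 'a"
  assumes R: "pseudo_resolvent U R"
  obtains P :: "complex \<Rightarrow> 'c \<Rightarrow>\<^sub>L 'c" where "pseudo_resolvent U P"
    "\<And>z x y. z \<in> U \<Longrightarrow> P z (tensor x y) = tensor (R z x) y"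
    "\<And>z. z \<in> U \<Longrightarrow> norm (P z) \<le> norm (R z)"
proof -
  have "\<forall>z. \<exists>L. z \<in> U \<longrightarrow> (\<forall>x y. blinfun_apply L (tensor x y) = tensor (R z x) y) \<and> norm L \<le> norm (R z) \<and>
      clinear_blinfun L"
  proof
    fix z
    show "\<exists>L. z \<in> U \<longrightarrow> (\<forall>x y. blinfun_apply L (tensor x y) = tensor (R z x) y) \<and> norm L \<le> norm (R z) \<and>
      clinear_blinfun L"
    proof (cases "z \<in> U")
      case True
      then have "clinear_blinfun (R z)" using R by (simp add: pseudo_resolvent_def)
      then show ?thesis by (rule tensor_left_exists) blast
    qed simp
  qed
  then obtain P :: "complex \<Rightarrow> 'c \<Rightarrow>\<^sub>L 'c" where P: "\<And>z x y. z \<in> U \<Longrightarrow> P z (tensor x y) = tensor (R z x) y"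
    "\<And>z. z \<in> U \<Longrightarrow> norm (P z) \<le> norm (R z)" "\<And>z. z \<in> U \<Longrightarrow> clinear_blinfun (P z)"
    by metis
  have "P z v - P w v = (z - w) *\<^sub>C P z (P w v)" if "z \<in> U" "w \<in> U" for z w v
  proof (rule bounded_linear_eq_on_tensors[OF tensor, where f = "\<lambda>v. P z v - P w v"])
    show "P z (tensor x y) - P w (tensor x y) = (z - w) *\<^sub>C P z (P w (tensor x y))" for x y
      using R that by (simp add: P pseudo_resolvent_def flip: tensor.diff_left tensor_scaleC_left)
    show "bounded_linear (\<lambda>v. P z v - P w v)"
      by (intro bounded_linear_sub blinfun.bounded_linear_right)
    show "bounded_linear (\<lambda>v. (z - w) *\<^sub>C P z (P w v))"
      by (intro bounded_linear_compose[OF bounded_linear_scaleC]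
          bounded_linear_compose[OF blinfun.bounded_linear_right blinfun.bounded_linear_right])
  qed
  with P show thesis by (intro that[of P]) (auto simp: pseudo_resolvent_def)
qed

end

section \<open>Operator-valued primitives and curve integrals\<close>

lemma bounded_bilinear_scaleC_blinfun:
  "bounded_bilinear (scaleC_blinfun :: complex \<Rightarrow> ('a::real_normed_vector \<Rightarrow>\<^sub>L 'b::complex_inner) \<Rightarrow> _)"
proof
  show "\<exists>K. \<forall>c (A :: 'a \<Rightarrow>\<^sub>L 'b). norm (scaleC_blinfun c A) \<le> norm c * norm A * K"
  proof (intro exI[of _ 1] allI)
    fix c and A :: "'a \<Rightarrow>\<^sub>L 'b"
    show "norm (scaleC_blinfun c A) \<le> norm c * norm A * 1"
      by (intro norm_blinfun_bound)
        (auto simp: blinfun_apply_scaleC_blinfun norm_scaleC mult.assoc intro: mult_left_mono norm_blinfun)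
  qed
qed (rule blinfun_eqI, simp add: blinfun_apply_scaleC_blinfun blinfun.add_left blinfun.scaleR_left
      scaleC.add_left scaleC.add_right scaleC.scaleR_left scaleC.scaleR_right)+

interpretation scaleC_blinfun: bounded_bilinear
  "scaleC_blinfun :: complex \<Rightarrow> ('a::real_normed_vector \<Rightarrow>\<^sub>L 'b::complex_inner) \<Rightarrow> _"
  by (rule bounded_bilinear_scaleC_blinfun)

lemma norm_scaleC_blinfun_le: "norm (scaleC_blinfun c A) \<le> cmod c * norm A"
  by (intro norm_blinfun_bound)
    (auto simp: blinfun_apply_scaleC_blinfun norm_scaleC mult.assoc intro: mult_left_mono norm_blinfun)

lemma bounded_linear_matrix_element: "bounded_linear (\<lambda>A. cinner \<xi> (blinfun_apply A \<eta>))"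
  by (rule bounded_linear_compose[OF cinner.bounded_linear_right blinfun.bounded_linear_left])

lemma blinfun_eq_matrix_elementI:
  fixes A B :: "'c::complex_hilbert \<Rightarrow>\<^sub>L 'c"
  assumes "\<And>\<xi> \<eta>. cinner \<xi> (A \<eta>) = cinner \<xi> (B \<eta>)"
  shows "A = B"
proof (rule blinfun_eqI)
  fix \<eta>
  have "A \<eta> - B \<eta> = 0"
    by (rule cinner_eq_0_imp) (simp add: cinner.diff_right assms)
  then show "A \<eta> = B \<eta>" by simp
qed

text \<open>Cauchy theory is used only for scalar matrix elements. It shows that the segment
  integrals \<open>J\<close> depend additively on their endpoints; norm continuity of
  \<open>F\<close> then gives differentiability of \<open>J\<close> from the centre in operator
  norm.\<close>

lemma operator_primitive_ball:
  fixes F :: "complex \<Rightarrow> 'c::complex_hilbert \<Rightarrow>\<^sub>L 'c"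
  assumes cont: "continuous_on (ball z\<^sub>0 r) F"
    and hol: "\<And>\<xi> \<eta>. (\<lambda>z. cinner \<xi> (F z \<eta>)) holomorphic_on ball z\<^sub>0 r"
  obtains G where "\<And>z. z \<in> ball z\<^sub>0 r \<Longrightarrow> (G has_derivative (\<lambda>h. scaleC_blinfun h (F z))) (at z)"
proof -
  define J where "J z w = integral {0..1} (\<lambda>s. scaleC_blinfun (w - z) (F (z + of_real s * (w - z))))" for z w
  have seg: "z + of_real s * (w - z) \<in> ball z\<^sub>0 r"
    if "z \<in> ball z\<^sub>0 r" "w \<in> ball z\<^sub>0 r" "s \<in> {0..1}" for z w s
  proof -
    have "(1 - s) *\<^sub>R z + s *\<^sub>R w \<in> ball z\<^sub>0 r"
      using that by (intro convexD_alt) auto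
    then show ?thesis by (simp add: scaleR_conv_of_real algebra_simps)
  qed
  have contF: "continuous_on {0..1} (\<lambda>s. F (z + of_real s * (w - z)))"
    if "z \<in> ball z\<^sub>0 r" "w \<in> ball z\<^sub>0 r" for z w
    by (rule continuous_on_compose2[OF cont]) (use seg[OF that] in \<open>auto intro!: continuous_intros\<close>)
  have int: "(\<lambda>s. scaleC_blinfun (w - z) (F (z + of_real s * (w - z)))) integrable_on {0..1}"
    if "z \<in> ball z\<^sub>0 r" "w \<in> ball z\<^sub>0 r" for z w
    by (intro integrable_continuous_interval scaleC_blinfun.continuous_on continuous_on_const contF that)
  have J_elem: "\<exists>g. \<forall>z\<in>ball z\<^sub>0 r. \<forall>w\<in>ball z\<^sub>0 r. cinner \<xi> (J z w \<eta>) = g w - g z" for \<xi> \<eta>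
  proof -
    obtain g where g: "\<And>z. z \<in> ball z\<^sub>0 r \<Longrightarrow>
        (g has_field_derivative cinner \<xi> (F z \<eta>)) (at z within ball z\<^sub>0 r)"
      using holomorphic_convex_primitive'[OF _ _ hol[of \<xi> \<eta>]] by auto
    have "cinner \<xi> (J z w \<eta>) = g w - g z" if z: "z \<in> ball z\<^sub>0 r" and w: "w \<in> ball z\<^sub>0 r" for z w
    proof -
      let ?h = "\<lambda>s. (w - z) * cinner \<xi> (F (z + of_real s * (w - z)) \<eta>)"
      have "((\<lambda>s. g (z + of_real s * (w - z))) has_vector_derivative ?h s) (at s within {0..1})"
        if s: "s \<in> {0..1}" for s
      proof -
        have "(g has_field_derivative cinner \<xi> (F (z + of_real s * (w - z)) \<eta>)) (at (z + of_real s * (w - z)))"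
          using g[OF seg[OF z w s]] at_within_open[OF seg[OF z w s] open_ball] by simp
        moreover have "((\<lambda>s. z + of_real s * (w - z)) has_vector_derivative (w - z)) (at s within {0..1})"
          by (auto intro!: derivative_eq_intros)
        ultimately show ?thesis
          using field_vector_diff_chain_within[of "\<lambda>s. z + of_real s * (w - z)" "w - z" s "{0..1}" g]
          by (auto simp: o_def intro: has_field_derivative_at_within)
      qed
      then have "(?h has_integral g (z + of_real 1 * (w - z)) - g (z + of_real 0 * (w - z))) {0..1}"
        by (intro fundamental_theorem_of_calculus) auto
      then have "integral {0..1} ?h = g w - g z"
        by (intro integral_unique) simp
      moreover have "cinner \<xi> (J z w \<eta>) = integral {0..1} ?h"
        unfolding J_def integral_linear[OF int[OF z w] bounded_linear_matrix_element, symmetric]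
        by (simp add: o_def blinfun_apply_scaleC_blinfun cinner_scaleC_right)
      ultimately show ?thesis by simp
    qed
    then show ?thesis by blast
  qed
  \<comment> \<open>Cauchy's theorem for a triangle, tested on matrix elements, where it becomes the
    telescoping of a scalar primitive.\<close>
  have J_add: "J z\<^sub>0 w - J z\<^sub>0 z = J z w" if z: "z \<in> ball z\<^sub>0 r" and w: "w \<in> ball z\<^sub>0 r" for z w
  proof (rule blinfun_eq_matrix_elementI)
    fix \<xi> \<eta>
    obtain g where g: "\<forall>z\<in>ball z\<^sub>0 r. \<forall>w\<in>ball z\<^sub>0 r. cinner \<xi> (J z w \<eta>) = g w - g z"
      using J_elem by blast
    have "0 < r" using z by (meson mem_ball dist_not_less_zero le_less_trans not_le)
    with g z w show "cinner \<xi> ((J z\<^sub>0 w - J z\<^sub>0 z) \<eta>) = cinner \<xi> (J z w \<eta>)"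
      by (simp add: blinfun.diff_left cinner.diff_right)
  qed
  have "(J z\<^sub>0 has_derivative (\<lambda>h. scaleC_blinfun h (F z))) (at z)" if z: "z \<in> ball z\<^sub>0 r" for z
    unfolding has_derivative_at_alt
  proof (intro conjI allI impI)
    show "bounded_linear (\<lambda>h. scaleC_blinfun h (F z))" by (rule scaleC_blinfun.bounded_linear_left)
    fix e :: real assume "0 < e"
    then obtain d1 where d1: "0 < d1" "\<And>w. w \<in> ball z\<^sub>0 r \<Longrightarrow> dist w z < d1 \<Longrightarrow> dist (F w) (F z) < e"
      using cont z unfolding continuous_on_iff by metis
    obtain d2 where d2: "0 < d2" "ball z d2 \<subseteq> ball z\<^sub>0 r"
      using openE[OF open_ball z] .
    have "norm (J z\<^sub>0 w - J z\<^sub>0 z - scaleC_blinfun (w - z) (F z)) \<le> e * norm (w - z)"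
      if wz: "norm (w - z) < min d1 d2" for w
    proof -
      have w: "w \<in> ball z\<^sub>0 r" using wz d2(2) by (auto simp: dist_norm norm_minus_commute subset_iff)
      let ?D = "\<lambda>s. scaleC_blinfun (w - z) (F (z + of_real s * (w - z)) - F z)"
      have "((\<lambda>s. scaleC_blinfun (w - z) (F (z + of_real s * (w - z))) - scaleC_blinfun (w - z) (F z))
          has_integral J z w - (1 - 0) *\<^sub>R scaleC_blinfun (w - z) (F z)) {0..1}"
        unfolding J_def
        using has_integral_const_real[of "scaleC_blinfun (w - z) (F z)" 0 1]
        by (intro has_integral_diff integrable_integral int z w) simp
      then have "(?D has_integral J z\<^sub>0 w - J z\<^sub>0 z - scaleC_blinfun (w - z) (F z)) {0..1}"
        by (simp add: J_add[OF z w] scaleC_blinfun.diff_right)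
      then have "norm (J z\<^sub>0 w - J z\<^sub>0 z - scaleC_blinfun (w - z) (F z)) \<le> (norm (w - z) * e) * measure lborel {0..1::real}"
      proof (rule has_integral_bound_real[OF _ finite.emptyI, rotated])
        fix s :: real assume s: "s \<in> {0..1} - {}"
        have "norm (of_real s * (w - z)) \<le> 1 * norm (w - z)"
          unfolding norm_mult using s by (intro mult_right_mono) auto
        then have "dist (z + of_real s * (w - z)) z < d1" using wz by (simp add: dist_norm)
        then have "norm (F (z + of_real s * (w - z)) - F z) \<le> e"
          using d1(2)[OF seg[OF z w]] s by (force simp: dist_norm)
        then show "norm (?D s) \<le> norm (w - z) * e"
          by (intro order_trans[OF norm_scaleC_blinfun_le] mult_left_mono) auto
      qed (use \<open>0 < e\<close> in simp)
      then show ?thesis by (simp add: mult.commute)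
    qed
    with d1 d2 show "\<exists>d>0. \<forall>w. norm (w - z) < d \<longrightarrow>
        norm (J z\<^sub>0 w - J z\<^sub>0 z - scaleC_blinfun (w - z) (F z)) \<le> e * norm (w - z)"
      by (intro exI[of _ "min d1 d2"]) auto
  qed
  then show thesis by (rule that)
qed

text \<open>The velocity of a piecewise \<open>C\<^sup>1\<close> curve may be unbounded near the exceptional points, so that
  integrability is not a matter of continuity: it comes from local primitives of \<open>F\<close>.\<close>

lemma curve_integrand_integrable_on_interval:
  fixes F :: "complex \<Rightarrow> 'c::complex_hilbert \<Rightarrow>\<^sub>L 'c"
  assumes \<gamma>: "\<gamma> piecewise_C1_differentiable_on UNIV" and U: "open U" "range \<gamma> \<subseteq> U"
    and cont: "continuous_on U F"
    and hol: "\<And>\<xi> \<eta>. (\<lambda>z. cinner \<xi> (F z \<eta>)) holomorphic_on U"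
  shows "curve_integrand \<gamma> F integrable_on cbox a b"
proof -
  obtain S where cont\<gamma>: "continuous_on UNIV \<gamma>" and S: "finite S" "\<gamma> C1_differentiable_on (UNIV - S)"
    using \<gamma> unfolding piecewise_C1_differentiable_on_def by blast
  have deriv: "(\<gamma> has_vector_derivative vector_derivative \<gamma> (at t)) (at t)" if "t \<notin> S" for t
    using S(2) that vector_derivative_works unfolding C1_differentiable_on_eq by blast
  show ?thesis
  proof (rule integrable_on_little_subintervals, intro ballI)
    fix t assume "t \<in> cbox a b"
    obtain r where r: "0 < r" "ball (\<gamma> t) r \<subseteq> U"
      using openE[OF U(1)] U(2) by blast
    obtain G where G: "\<And>z. z \<in> ball (\<gamma> t) r \<Longrightarrow> (G has_derivative (\<lambda>h. scaleC_blinfun h (F z))) (at z)"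
      using operator_primitive_ball[OF continuous_on_subset[OF cont r(2)] holomorphic_on_subset[OF hol r(2)]]
      by blast
    obtain d where d: "0 < d" "\<And>s. dist s t < d \<Longrightarrow> dist (\<gamma> s) (\<gamma> t) < r"
      using cont\<gamma> r(1) unfolding continuous_on_iff by (metis UNIV_I)
    have in_ball: "\<gamma> s \<in> ball (\<gamma> t) r" if "s \<in> ball t d" for s
      using d(2)[of s] that by (simp add: dist_commute)
    have "curve_integrand \<gamma> F integrable_on cbox u v" if uv: "t \<in> cbox u v" "cbox u v \<subseteq> ball t d" for u v
    proof -
      \<comment> \<open>This version of the fundamental theorem asks only for continuity of the
        composite and differentiability off a finite set, so the velocity may blow up at the
        exceptional points.\<close>
      have "((curve_integrand \<gamma> F) has_integral (G \<circ> \<gamma>) v - (G \<circ> \<gamma>) u) {u..v}"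
      proof (rule fundamental_theorem_of_calculus_interior_strong[OF S(1)])
        show "u \<le> v" using uv(1) by simp
        fix s assume s: "s \<in> {u<..<v} - S"
        then have "s \<in> ball t d" using uv(2) by (simp add: box_real subset_iff)
        note DG = G[OF in_ball[OF this]]
        have "(\<gamma> has_derivative (\<lambda>h. h *\<^sub>R vector_derivative \<gamma> (at s))) (at s)"
          using deriv s by (simp add: has_vector_derivative_def)
        from diff_chain_at[OF this DG]
        show "((G \<circ> \<gamma>) has_vector_derivative curve_integrand \<gamma> F s) (at s)"
          by (simp add: has_vector_derivative_def curve_integrand_def o_def scaleC_blinfun.scaleR_left)
      next
        have "continuous_on (ball (\<gamma> t) r) G"
          using G has_derivative_continuous continuous_at_imp_continuous_on by blast
        moreover have "\<gamma> ` {u..v} \<subseteq> ball (\<gamma> t) r"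
          using in_ball uv(2) by (auto simp: box_real)
        ultimately show "continuous_on {u..v} (G \<circ> \<gamma>)"
          unfolding o_def
          by (rule continuous_on_compose2[OF _ continuous_on_subset[OF cont\<gamma> subset_UNIV]])
      qed
      then show ?thesis by (auto simp: box_real)
    qed
    with d(1) show "\<exists>d>0. \<forall>u v. t \<in> cbox u v \<and> cbox u v \<subseteq> ball t d \<and> cbox u v \<subseteq> cbox a b \<longrightarrow>
        curve_integrand \<gamma> F integrable_on cbox u v"
      by blast
  qed
qed

section \<open>Improper integrals over the real line\<close>

lemma integrable_inverse_square_outside:
  fixes N :: real
  assumes "0 < N"
  shows "(\<lambda>t. if \<bar>t\<bar> \<le> N then 0 else C / t\<^sup>2) integrable_on UNIV"
proof -
  have R: "(\<lambda>t. 1 / t ^ 2) integrable_on {N..}"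
    using has_integral_inverse_power_to_inf[of 2 N] assms by auto
  have "(\<lambda>t. 1 / t ^ 2) absolutely_integrable_on {N..}"
    using R by (rule nonnegative_absolutely_integrable_1) simp
  then have "(\<lambda>t. 1 / (- t) ^ 2) absolutely_integrable_on {..- N}"
    using has_absolute_integral_reflect_real[of "{N..}" "{..- N}" "\<lambda>t. 1 / t ^ 2"] by auto
  then have L: "(\<lambda>t. 1 / t ^ 2) integrable_on {..- N}"
    using set_lebesgue_integral_eq_integral(1) by simp blast
  have "(\<lambda>t. 1 / t ^ 2) integrable_on {..- N} \<union> {N..}"
  proof (intro integrable_Un L R)
    have "{..- N} \<inter> {N..} = {}" using assms by auto
    then show "negligible ({..- N} \<inter> {N..})" by simp
  qed
  from integrable_cmul[OF this, of C] have "(\<lambda>t. C / t\<^sup>2) integrable_on {..- N} \<union> {N..}"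
    by simp
  then have "(\<lambda>t. if t \<in> {..- N} \<union> {N..} then C / t\<^sup>2 else 0) integrable_on UNIV"
    by (subst integrable_restrict_UNIV)
  then show ?thesis
    \<comment> \<open>The closed half-lines include the points \<open>N\<close> and
      \<open>- N\<close>, where the target function is 0.\<close>
    by (rule integrable_spike[where S = "{N, - N}"]) auto
qed

lemma integrable_on_UNIV_inverse_square_decay:
  fixes f :: "real \<Rightarrow> 'a::banach"
  assumes int: "\<And>a b. f integrable_on cbox a b" and N: "0 < N"
    and decay: "\<And>t. N < \<bar>t\<bar> \<Longrightarrow> norm (f t) \<le> C / t\<^sup>2"
  shows "f integrable_on UNIV"
proof -
  let ?g = "\<lambda>t. if t \<in> cbox (- N) N then f t else 0"
  have g: "?g integrable_on UNIV"
    using int[of "- N" N] by (subst integrable_restrict_UNIV)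
  have "(\<lambda>t. f t - ?g t) integrable_on UNIV"
  proof (rule integrable_on_all_intervals_UNIV)
    show "(\<lambda>t. f t - ?g t) integrable_on cbox a b" for a b
      by (intro integrable_diff int integrable_on_subcbox[OF g]) simp
    show "norm (f t - ?g t) \<le> (if \<bar>t\<bar> \<le> N then 0 else C / t\<^sup>2)" for t
      using decay[of t] by (auto simp: abs_le_iff)
  qed (rule integrable_inverse_square_outside[OF N])
  from integrable_add[OF this g] show ?thesis by simp
qed

lemma has_integral_UNIV_LIMSEQ:
  fixes f :: "real \<Rightarrow> 'a::banach"
  assumes f: "(f has_integral I) UNIV" and X: "\<And>n. (f has_integral X n) {- real n..real n}"
  shows "X \<longlonglongrightarrow> I"
proof (rule LIMSEQ_I)
  fix e :: real assume "0 < e"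
  then obtain B where B: "0 < B" "\<And>a b. ball 0 B \<subseteq> cbox a b \<Longrightarrow> norm (integral (cbox a b) f - I) < e"
    using f unfolding has_integral_alt'[of f I UNIV] by auto
  obtain M where M: "B \<le> real M" using real_arch_simple by blast
  have "norm (X n - I) < e" if "M \<le> n" for n
  proof -
    have "ball 0 B \<subseteq> cbox (- real n) (real n)"
      using M that by (auto simp: dist_norm)
    then have "norm (integral (cbox (- real n) (real n)) f - I) < e" by (rule B(2))
    then show ?thesis using X[of n] by (simp add: box_real integral_unique)
  qed
  then show "\<exists>no. \<forall>n\<ge>no. norm (X n - I) < e" by blast
qed

text \<open>Riemann sums stay in the subspace, and so do their limits. With the graph of a closed
  operator as the subspace, this lets the operator be moved inside an integral (Hille's
  theorem).\<close>

lemma has_integral_closed_subspace: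
  fixes f :: "real \<Rightarrow> 'a::banach"
  assumes S: "subspace S" "closed S" and f: "(f has_integral I) UNIV" "\<And>t. f t \<in> S"
  shows "I \<in> S"
proof -
  have box: "J \<in> S" if J: "(f has_integral J) (cbox a b)" for a b J
  proof -
    have "\<exists>y\<in>S. dist y J < e" if e: "0 < e" for e
    proof -
      obtain \<gamma> where \<gamma>: "gauge \<gamma>"
        "\<And>p. p tagged_division_of cbox a b \<Longrightarrow> \<gamma> fine p \<Longrightarrow> norm ((\<Sum>(x, k)\<in>p. measure lborel k *\<^sub>R f x) - J) < e"
        using has_integralD[OF J e] by blast
      obtain p where p: "p tagged_division_of cbox a b" "\<gamma> fine p"
        using fine_division_exists[OF \<gamma>(1)] .
      have "(\<Sum>(x, k)\<in>p. measure lborel k *\<^sub>R f x) \<in> S"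
        by (intro subspace_sum[OF S(1)]) (auto intro: subspace_mul[OF S(1)] f(2))
      with \<gamma>(2)[OF p] show ?thesis by (auto simp: dist_norm)
    qed
    then show ?thesis using S(2) closure_approachable[of J S] by simp
  qed
  have int: "f integrable_on {- real n..real n}" for n
    using integrable_on_subcbox[OF has_integral_integrable[OF f(1)], of "- real n" "real n"]
    by (simp add: box_real)
  have lim: "(\<lambda>n. integral {- real n..real n} f) \<longlonglongrightarrow> I"
    by (rule has_integral_UNIV_LIMSEQ[OF f(1)]) (use int in blast)
  have mem: "integral {- real n..real n} f \<in> S" for n
    using box[of _ "- real n" "real n"] int[of n] by (simp add: box_real has_integral_integral)
  show ?thesis by (rule closed_sequentially[OF S(2) mem lim])
qed

section \<open>Asymptotics of scalar primitives\<close>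

text \<open>Factoring out the positive number n splits off ln n without changing the branch; what
  remains converges to \<open>e\<close>, where the principal logarithm is continuous.\<close>

lemma Ln_line_asymptotics:
  assumes e: "e \<notin> \<real>\<^sub>\<le>\<^sub>0"
  shows "(\<lambda>n. Ln (d + of_real (real n) * e) - of_real (ln (real n))) \<longlonglongrightarrow> Ln e"
proof -
  have "(\<lambda>n. e + d * of_real (inverse (real n))) \<longlonglongrightarrow> e + d * of_real 0"
    by (intro tendsto_intros lim_inverse_n)
  then have lim: "(\<lambda>n. e + d * of_real (inverse (real n))) \<longlonglongrightarrow> e" by simp
  have "e \<noteq> 0" using e by auto
  with lim have "\<forall>\<^sub>F n in sequentially. e + d * of_real (inverse (real n)) \<noteq> 0"
    by (rule tendsto_imp_eventually_ne)
  with eventually_gt_at_top[of 0]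
  have "\<forall>\<^sub>F n in sequentially. Ln (e + d * of_real (inverse (real n)))
      = Ln (d + of_real (real n) * e) - of_real (ln (real n))"
  proof eventually_elim
    case (elim n)
    have "d + of_real (real n) * e = of_real (real n) * (e + d * of_real (inverse (real n)))"
      using elim(1) by (simp add: field_simps)
    also have "Ln \<dots> = of_real (ln (real n)) + Ln (e + d * of_real (inverse (real n)))"
      using elim by (subst Ln_times_of_real) (auto simp: Ln_of_real)
    finally show ?case by simp
  qed
  moreover have "(\<lambda>n. Ln (e + d * of_real (inverse (real n)))) \<longlonglongrightarrow> Ln e"
    by (rule tendsto_Ln[OF lim e])
  ultimately show ?thesis by (rule Lim_transform_eventually[rotated])
qed

text \<open>The branch jump responsible for the constant 2 \<pi> i.\<close>

lemma Ln_uminus_upper: "0 < Im c \<Longrightarrow> Ln (- c) = Ln c - \<i> * of_real pi"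
  by (subst Ln_minus) auto

text \<open>Near its left end the segment still has very negative real part; elsewhere its imaginary
  part is already of order n. The alternative in the conclusion matches the two available resolvent
  bounds.\<close>

lemma segment_far_from_ray:
  assumes e: "Im e \<noteq> 0"
  obtains \<delta> N where "0 < \<delta>"
    and "\<And>n z. N \<le> n \<Longrightarrow> z \<in> closed_segment (- of_real n) (d + of_real n * e) \<Longrightarrow>
      \<delta> * n \<le> \<bar>Im z\<bar> \<or> \<delta> * n \<le> m - Re z"
proof -
  \<comment> \<open>Below the parameter \<open>s0\<close> the direction \<open>e\<close> can move
    the point right by at most n / 4 and the weight lost at -n costs at most another n / 4, leaving
    the real part below |d| - n / 2.\<close>
  define s0 where "s0 = 1 / (4 * (1 + cmod e))"
  have s0: "0 < s0" "s0 \<le> 1/4" "s0 * cmod e \<le> 1/4"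
    by (auto simp: s0_def field_simps add_pos_nonneg)
  define \<delta> where "\<delta> = min (s0 * \<bar>Im e\<bar> / 2) (1/4)"
  have \<delta>: "0 < \<delta>" using s0 e by (simp add: \<delta>_def)
  define M where "M = \<bar>m\<bar>"
  have M: "0 \<le> M" "- M \<le> m" by (auto simp: M_def)
  \<comment> \<open>The first entry lets n |Im e| dominate the offset Im d with half of it to spare;
    the second makes |d| + |m| at most n / 4.\<close>
  define N where "N = max (2 * \<bar>Im d\<bar> / \<bar>Im e\<bar>) (4 * cmod d + 4 * M)"
  have "\<delta> * n \<le> \<bar>Im z\<bar> \<or> \<delta> * n \<le> m - Re z"
    if n: "N \<le> n" and z: "z \<in> closed_segment (- of_real n) (d + of_real n * e)" for n z
  proof -
    have N: "2 * \<bar>Im d\<bar> \<le> n * \<bar>Im e\<bar>" "4 * cmod d + 4 * M \<le> n"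
      using n e by (auto simp: N_def pos_divide_le_eq)
    have n0: "0 \<le> n" by (rule order_trans[OF _ N(2)]) (simp add: M(1))
    obtain s where s: "0 \<le> s" "s \<le> 1" and zeq: "z = (1 - s) *\<^sub>R (- of_real n) + s *\<^sub>R (d + of_real n * e)"
      using z unfolding closed_segment_def by blast
    have Im: "Im z = s * (Im d + n * Im e)" and Re: "Re z = s * (Re d + n * Re e) - (1 - s) * n"
      unfolding zeq by simp_all
    show ?thesis
    proof (cases "s0 \<le> s")
      case True
      have "n * \<bar>Im e\<bar> / 2 \<le> \<bar>Im d + n * Im e\<bar>"
        using N(1) n0 abs_triangle_ineq[of "Im d + n * Im e" "- Im d"] by (simp add: abs_mult)
      then have "s0 * (n * \<bar>Im e\<bar> / 2) \<le> s * \<bar>Im d + n * Im e\<bar>"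
        using True s0 n0 by (intro mult_mono) auto
      also have "\<dots> = \<bar>Im z\<bar>" using s by (simp add: Im abs_mult)
      finally have "(s0 * \<bar>Im e\<bar> / 2) * n \<le> \<bar>Im z\<bar>" by (simp add: ac_simps)
      moreover have "\<delta> * n \<le> (s0 * \<bar>Im e\<bar> / 2) * n"
        using n0 by (intro mult_right_mono) (auto simp: \<delta>_def)
      ultimately show ?thesis by linarith
    next
      case False
      have "s * Re d \<le> 1 * cmod d"
        by (rule order_trans[OF mult_left_mono[OF complex_Re_le_cmod s(1)] mult_right_mono[OF s(2)]]) simp
      moreover have "s * Re e \<le> 1/4"
      proof -
        have "s * Re e \<le> s * cmod e" using s by (intro mult_left_mono complex_Re_le_cmod)
        also have "\<dots> \<le> s0 * cmod e" using False by (intro mult_right_mono) auto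
        finally show ?thesis using s0 by linarith
      qed
      then have "(s * Re e) * n \<le> 1/4 * n" using n0 by (rule mult_right_mono)
      moreover have "s * n \<le> 1/4 * n" using False s0 n0 by (intro mult_right_mono) auto
      moreover have "Re z = s * Re d + (s * Re e) * n - n + s * n" by (simp add: Re algebra_simps)
      ultimately have "Re z \<le> cmod d - n / 2" by linarith
      moreover have "\<delta> * n \<le> 1/4 * n" using n0 by (intro mult_right_mono) (auto simp: \<delta>_def)
      ultimately have "\<delta> * n \<le> m - Re z" using N(2) M(2) by linarith
      then show ?thesis ..
    qed
  qed
  with \<delta> show thesis by (rule that)
qed

section \<open>Slit planes and logarithmic primitives\<close>

lemma right_ray_ereal: "z \<in> right_ray (ereal l) \<longleftrightarrow> Im z = 0 \<and> l \<le> Re z"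
  by (auto simp: right_ray_def complex_eq_iff)

lemma open_off_ray: "open (- right_ray (ereal l))"
proof -
  have "right_ray (ereal l) = {z. Im z = 0} \<inter> {z. l \<le> Re z}"
    by (auto simp: right_ray_ereal)
  moreover have "closed \<dots>"
    by (intro closed_Int closed_Collect_eq closed_Collect_le continuous_intros)
  ultimately have "closed (right_ray (ereal l))" by simp
  then show ?thesis by (rule open_Compl)
qed

text \<open>Any real point left of the slit is a star centre, here \<open>l - 1\<close>.
  Starlikeness provides a single primitive on the whole slit plane, valid at both ends of the
  curve.\<close>

lemma starlike_off_ray: "starlike (- right_ray (ereal l))"
  unfolding starlike_def
proof (intro bexI ballI subsetI)
  let ?a = "complex_of_real (l - 1)"
  show "?a \<in> - right_ray (ereal l)" by (simp add: right_ray_ereal)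
  fix z w assume z: "z \<in> - right_ray (ereal l)" and "w \<in> closed_segment ?a z"
  then obtain s where s: "0 \<le> s" "s \<le> 1" and w: "w = (1 - s) *\<^sub>R ?a + s *\<^sub>R z"
    unfolding closed_segment_def by blast
  have "w \<notin> right_ray (ereal l)"
  proof
    assume "w \<in> right_ray (ereal l)"
    then have "s * Im z = 0" and le: "1 - s \<le> s * (Re z - l)"
      by (simp_all add: right_ray_ereal w algebra_simps)
    moreover have "s \<noteq> 0" using le by auto
    ultimately have "Im z = 0" "Re z < l" using z by (auto simp: right_ray_ereal)
    then have "s * (Re z - l) < 0" using s \<open>s \<noteq> 0\<close> by (intro mult_pos_neg) auto
    with le s show False by linarith
  qed
  then show "w \<in> - right_ray (ereal l)" by simp
qed

text \<open>For \<open>x\<close> in the domain, \<open>R z x\<close> differs from \<open>x / (l - z)\<close> by a term of order \<open>1 / \<bar>z\<bar>\<^sup>2\<close> away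
  from the positive axis, so its primitive behaves like \<open>- Ln (l - z)\<close> at infinity.\<close>

lemma resolvent_primitive:
  fixes H :: "'a::complex_hilbert operator" and \<phi> :: "'a \<Rightarrow> complex"
  assumes sa: "self_adjoint H" and m: "\<And>x u. (x, u) \<in> H \<Longrightarrow> m * (norm x)\<^sup>2 \<le> Re (cinner x u)"
    and l: "inf_spec H = ereal l" "m \<le> l"
    and \<phi>: "bounded_linear \<phi>" "\<And>c x. \<phi> (c *\<^sub>C x) = c * \<phi> x"
    and xu: "(x, u) \<in> H"
  obtains K where "\<And>z. z \<notin> right_ray (ereal l) \<Longrightarrow> (K has_field_derivative \<phi> (resolvent H z x)) (at z)"
    and "\<And>d e d' e'. Im e \<noteq> 0 \<Longrightarrow> Im e' \<noteq> 0 \<Longrightarrow>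
      (\<lambda>n. K (d + of_real (real n) * e) - K (d' + of_real (real n) * e')) \<longlonglongrightarrow> \<phi> x * (Ln (- e') - Ln (- e))"
proof -
  let ?U = "- right_ray (ereal l)"
  have res: "is_resolvent H z (resolvent H z)" if "z \<in> ?U" for z
    using resolvent_off_ray[OF sa] that l(1) by simp
  have pr: "pseudo_resolvent ?U (resolvent H)"
    by (rule pseudo_resolvent_resolvent[OF sa res])
  have hol: "(\<lambda>z. \<phi> (resolvent H z x)) holomorphic_on ?U"
    by (rule pseudo_resolvent_holomorphic[OF pr open_off_ray \<phi>])
  obtain K where K: "\<And>z. z \<in> ?U \<Longrightarrow> (K has_field_derivative \<phi> (resolvent H z x)) (at z)"
    using holomorphic_starlike_primitive[OF holomorphic_on_imp_continuous_on[OF hol] starlike_off_ray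
        open_off_ray finite.emptyI] holomorphic_on_imp_differentiable_at[OF hol open_off_ray]
    by (metis Diff_empty)
  \<comment> \<open>Adding the logarithm removes the part of order 1 / |z| from the derivative,
    which becomes \<open>rem\<close>.\<close>
  define L where "L z = K z + \<phi> x * Ln (of_real l - z)" for z
  define rem where "rem z = \<phi> (resolvent H z x) - \<phi> x / (of_real l - z)" for z
  have L: "(L has_field_derivative rem z) (at z)" if "z \<in> ?U" for z
  proof -
    have "of_real l - z \<notin> \<real>\<^sub>\<le>\<^sub>0"
      using that by (auto simp: complex_nonpos_Reals_iff right_ray_ereal)
    moreover from this have "of_real l - z \<noteq> 0" by auto
    ultimately show ?thesis
      unfolding L_def rem_def using K[OF that]
      by (auto intro!: derivative_eq_intros simp: divide_simps)
  qed
  obtain k where k: "\<And>v. norm (\<phi> v) \<le> norm v * k" "0 \<le> k"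
    using bounded_linear.nonneg_bounded[OF \<phi>(1)] by blast
  define C where "C = k * norm (u - complex_of_real l *\<^sub>C x)"
  have C: "0 \<le> C" using k by (simp add: C_def)
  have far: "z \<in> ?U \<and> norm (rem z) \<le> C / D\<^sup>2" if D: "0 < D" "D \<le> \<bar>Im z\<bar> \<or> D \<le> m - Re z" for z D
  proof
    show z: "z \<in> ?U" using D l(2) by (auto simp: right_ray_ereal)
    have nR: "norm (resolvent H z) \<le> 1 / D"
      using D(2)
    proof
      assume "D \<le> \<bar>Im z\<bar>"
      then have "norm (resolvent H z) \<le> 1 / \<bar>Im z\<bar>" "1 / \<bar>Im z\<bar> \<le> 1 / D"
        using D(1) resolvent_nonreal[OF sa, of z] by (auto intro: frac_le)
      then show ?thesis by linarith
    next
      assume "D \<le> m - Re z"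
      then have "norm (resolvent H z) \<le> 1 / (m - Re z)" "1 / (m - Re z) \<le> 1 / D"
        using D(1) resolvent_left[OF sa m, of z] by (auto intro: frac_le)
      then show ?thesis by linarith
    qed
    have zl: "D \<le> cmod (z - of_real l)"
      using D(2) l(2) abs_Im_le_cmod[of "z - of_real l"] abs_Re_le_cmod[of "z - of_real l"] by auto
    have "resolvent H z (u - z *\<^sub>C x) = x"
      using res[OF z] xu by (auto simp: is_resolvent_iff)
    moreover have split: "u - complex_of_real l *\<^sub>C x = (u - z *\<^sub>C x) + (z - of_real l) *\<^sub>C x"
      by (simp add: scaleC.diff_left)
    moreover have "resolvent H z ((z - of_real l) *\<^sub>C x) = (z - of_real l) *\<^sub>C resolvent H z x"
      using pr z unfolding pseudo_resolvent_def clinear_blinfun_def by blast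
    ultimately have "resolvent H z (u - complex_of_real l *\<^sub>C x) = x + (z - of_real l) *\<^sub>C resolvent H z x"
      by (simp only: split blinfun.add_right)
    then have R\<phi>: "\<phi> (resolvent H z (u - complex_of_real l *\<^sub>C x)) = \<phi> x + (z - of_real l) * \<phi> (resolvent H z x)"
      by (simp add: linear_add[OF bounded_linear.linear[OF \<phi>(1)]] \<phi>(2))
    have "z \<noteq> of_real l" using zl D(1) by auto
    \<comment> \<open>Rewriting \<open>rem\<close> as R(z) (H - l) x divided by z - l exposes two
      factors, each of order 1 / D.\<close>
    have "rem z = \<phi> (resolvent H z (u - complex_of_real l *\<^sub>C x)) / (z - of_real l)"
    proof -
      have "\<phi> x / (of_real l - z) = - (\<phi> x / (z - of_real l))"
        by (metis divide_minus_right minus_diff_eq)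
      with \<open>z \<noteq> of_real l\<close> R\<phi> show ?thesis
        by (simp add: rem_def add_divide_distrib)
    qed
    then have "norm (rem z) = norm (\<phi> (resolvent H z (u - complex_of_real l *\<^sub>C x))) / cmod (z - of_real l)"
      by (simp add: norm_divide)
    also have "\<dots> \<le> (C / D) / D"
    proof (rule frac_le)
      have "norm (\<phi> (resolvent H z (u - complex_of_real l *\<^sub>C x)))
          \<le> norm (resolvent H z (u - complex_of_real l *\<^sub>C x)) * k"
        by (rule k)
      also have "\<dots> \<le> (1 / D * norm (u - complex_of_real l *\<^sub>C x)) * k"
        by (intro mult_right_mono order_trans[OF norm_blinfun] nR k(2)) simp
      finally show "norm (\<phi> (resolvent H z (u - complex_of_real l *\<^sub>C x))) \<le> C / D"
        by (simp add: C_def mult.commute)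
    qed (use C D zl in auto)
    finally show "norm (rem z) \<le> C / D\<^sup>2" by (simp add: power2_eq_square)
  qed
  \<comment> \<open>The segment has length of order n and \<open>rem\<close> is of order 1 / n^2 on
    it, so the increment of \<open>L\<close> is of order 1 / n. The common point -n lets any two
    nonreal directions be compared, even across the slit.\<close>
  have L0: "(\<lambda>n. L (d + of_real (real n) * e) - L (- of_real (real n))) \<longlonglongrightarrow> 0" if e: "Im e \<noteq> 0" for d e
  proof -
    obtain \<delta> N where \<delta>: "0 < \<delta>" and seg: "\<And>n z. N \<le> n \<Longrightarrow>
        z \<in> closed_segment (- of_real n) (d + of_real n * e) \<Longrightarrow> \<delta> * n \<le> \<bar>Im z\<bar> \<or> \<delta> * n \<le> m - Re z"
      using segment_far_from_ray[OF e] by metis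
    define M where "M = C / \<delta>\<^sup>2 * (cmod d + cmod e + 1)"
    obtain n0 where n0: "N \<le> real n0" using real_arch_simple by blast
    have "norm (L (d + of_real (real n) * e) - L (- of_real (real n))) \<le> M * inverse (real n)"
      if n: "max 1 n0 \<le> n" for n
    proof -
      have n1: "1 \<le> real n" and nN: "N \<le> real n" using n n0 by auto
      let ?S = "closed_segment (- of_real (real n)) (d + of_real (real n) * e)"
      have fz: "z \<in> ?U \<and> norm (rem z) \<le> C / (\<delta> * real n)\<^sup>2" if "z \<in> ?S" for z
        using far[OF _ seg[OF nN that]] \<delta> n1 by simp
      have "norm (L (d + of_real (real n) * e) - L (- of_real (real n)))
          \<le> C / (\<delta> * real n)\<^sup>2 * norm (d + of_real (real n) * e - (- of_real (real n)))"
        by (rule field_differentiable_bound[where S = ?S and f' = rem])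
          (use fz L in \<open>auto intro: has_field_derivative_at_within\<close>)
      also have "\<dots> \<le> C / (\<delta> * real n)\<^sup>2 * (real n * (cmod d + cmod e + 1))"
      proof (rule mult_left_mono)
        have "norm (d + of_real (real n) * e + of_real (real n)) \<le> cmod d + real n * cmod e + real n"
          by (intro order_trans[OF norm_triangle_ineq] add_mono) (simp_all add: norm_mult)
        moreover have "cmod d \<le> real n * cmod d" using n1 by (simp add: mult_le_cancel_right1)
        ultimately show "norm (d + of_real (real n) * e - (- of_real (real n))) \<le> real n * (cmod d + cmod e + 1)"
          by (simp add: algebra_simps)
      qed (use C in simp)
      also have "C / (\<delta> * real n)\<^sup>2 * (real n * (cmod d + cmod e + 1)) = M * inverse (real n)"
        using n1 \<delta> by (simp add: M_def field_simps power2_eq_square)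
      finally show ?thesis .
    qed
    then have ev: "\<forall>\<^sub>F n in sequentially.
        norm (L (d + of_real (real n) * e) - L (- of_real (real n))) \<le> M * inverse (real n)"
      unfolding eventually_sequentially by blast
    have "(\<lambda>n. M * inverse (real n)) \<longlonglongrightarrow> M * 0"
      by (intro tendsto_mult tendsto_const lim_inverse_n)
    then show ?thesis using Lim_null_comparison[OF ev] by simp
  qed
  show thesis
  proof (rule that[of K])
    show "(K has_field_derivative \<phi> (resolvent H z x)) (at z)" if "z \<notin> right_ray (ereal l)" for z
      using K that by simp
    fix d e d' e' :: complex assume e: "Im e \<noteq> 0" "Im e' \<noteq> 0"
    have neg: "- e \<notin> \<real>\<^sub>\<le>\<^sub>0" "- e' \<notin> \<real>\<^sub>\<le>\<^sub>0"
      using e by (auto simp: complex_nonpos_Reals_iff)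
    \<comment> \<open>This is l - (d + n e) written as a line with direction -e; the two copies of
      ln n cancel in the difference below.\<close>
    let ?Ln = "\<lambda>d e n. Ln ((of_real l - d) + of_real (real n) * (- e)) - of_real (ln (real n))"
    have "(\<lambda>n. (L (d + of_real (real n) * e) - L (- of_real (real n)))
          - (L (d' + of_real (real n) * e') - L (- of_real (real n)))
          + \<phi> x * (?Ln d' e' n - ?Ln d e n)) \<longlonglongrightarrow> 0 - 0 + \<phi> x * (Ln (- e') - Ln (- e))"
      by (intro tendsto_intros L0 e Ln_line_asymptotics neg)
    then show "(\<lambda>n. K (d + of_real (real n) * e) - K (d' + of_real (real n) * e'))
        \<longlonglongrightarrow> \<phi> x * (Ln (- e') - Ln (- e))"
      by (simp add: L_def algebra_simps)
  qed
qed

section \<open>The resolvent of a tensor sum\<close>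

lemma tensor_sum_subspace: "subspace (tensor_sum tensor H\<^sub>1 H\<^sub>2)"
  and tensor_sum_closed: "closed (tensor_sum tensor H\<^sub>1 H\<^sub>2)"
  by (simp_all add: tensor_sum_def subspace_closure)

lemma tensor_sum_generator:
  assumes "(x, u) \<in> H\<^sub>1" "(y, v) \<in> H\<^sub>2"
  shows "(tensor x y, tensor u y + tensor x v) \<in> tensor_sum tensor H\<^sub>1 H\<^sub>2"
  unfolding tensor_sum_def
  by (rule closure_subset[THEN subsetD], rule span_base) (use assms in blast)

text \<open>Both inverse relations are closed linear conditions. The left one is tested on the pairs
  generating the graph, the right one on tensors of domain vectors, where closedness of
  \<open>tensor_sum\<close> permits passing to limits.\<close>

lemma is_resolvent_tensor_sum:
  fixes B :: "'c::complex_hilbert \<Rightarrow>\<^sub>L 'c" and H\<^sub>1 :: "'a::complex_hilbert operator"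
    and H\<^sub>2 :: "'b::complex_hilbert operator"
  assumes tensor: "hilbert_tensor_product tensor"
    and dense: "closure (Domain H\<^sub>1) = UNIV" "closure (Domain H\<^sub>2) = UNIV"
    and left: "\<And>x u y v. (x, u) \<in> H\<^sub>1 \<Longrightarrow> (y, v) \<in> H\<^sub>2 \<Longrightarrow>
      B (tensor u y + tensor x v - \<mu> *\<^sub>C tensor x y) = tensor x y"
    and right: "\<And>x u y v. (x, u) \<in> H\<^sub>1 \<Longrightarrow> (y, v) \<in> H\<^sub>2 \<Longrightarrow>
      (B (tensor x y), tensor x y + \<mu> *\<^sub>C B (tensor x y)) \<in> tensor_sum tensor H\<^sub>1 H\<^sub>2"
  shows "is_resolvent (tensor_sum tensor H\<^sub>1 H\<^sub>2) \<mu> B"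
  unfolding is_resolvent_iff
proof (intro conjI allI impI)
  interpret tensor: bounded_bilinear tensor by (rule bounded_bilinear_tensor[OF tensor])
  let ?H = "tensor_sum tensor H\<^sub>1 H\<^sub>2"
  let ?E = "{p. B (snd p - \<mu> *\<^sub>C fst p) = fst p}"
  have "subspace ?E"
    by (auto simp: subspace_def blinfun.diff_right blinfun.add_right blinfun.zero_right scaleC.zero_right
        scaleC.add_right scaleC.scaleR_right blinfun.scaleR_right algebra_simps
        simp flip: scaleR_diff_right)
  moreover have "closed ?E"
    by (intro closed_Collect_eq continuous_intros blinfun.continuous_on)
  ultimately have "?H \<subseteq> ?E"
    unfolding tensor_sum_def using left by (intro closure_minimal span_minimal) auto
  then show "B (\<zeta> - \<mu> *\<^sub>C \<xi>) = \<xi>" if "(\<xi>, \<zeta>) \<in> ?H" for \<xi> \<zeta> using that by auto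
next
  interpret tensor: bounded_bilinear tensor by (rule bounded_bilinear_tensor[OF tensor])
  let ?H = "tensor_sum tensor H\<^sub>1 H\<^sub>2"
  define g where "g \<eta> = (B \<eta>, \<eta> + \<mu> *\<^sub>C B \<eta>)" for \<eta>
  have g: "bounded_linear g"
    unfolding g_def
    by (intro bounded_linear_Pair bounded_linear_add bounded_linear_ident blinfun.bounded_linear_right
        bounded_linear_compose[OF bounded_linear_scaleC blinfun.bounded_linear_right])
  have cont: "continuous_on UNIV (\<lambda>\<eta>. g (f \<eta>))" if "continuous_on UNIV f" for f :: "'d::topological_space \<Rightarrow> 'c"
    by (rule bounded_linear.continuous_on[OF g that])
  have cl: "closed {\<eta>. g (f \<eta>) \<in> ?H}" if "continuous_on UNIV f" for f :: "'d::topological_space \<Rightarrow> 'c"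
    using closed_vimage[OF tensor_sum_closed cont[OF that]] by (simp add: vimage_def)
  \<comment> \<open>Density is applied to one variable at a time, first for \<open>y\<close> with
    \<open>x\<close> in the domain, then for \<open>x\<close>.\<close>
  have tens: "g (tensor x y) \<in> ?H" for x y
  proof -
    have 1: "g (tensor x y) \<in> ?H" if x: "x \<in> Domain H\<^sub>1" for x y
    proof -
      have "Domain H\<^sub>2 \<subseteq> {y. g (tensor x y) \<in> ?H}" using right x by (auto simp: g_def)
      then have "closure (Domain H\<^sub>2) \<subseteq> {y. g (tensor x y) \<in> ?H}"
        by (rule closure_minimal) (intro cl tensor.continuous_on continuous_on_const continuous_on_id)
      then show ?thesis using dense(2) by auto
    qed
    then have "Domain H\<^sub>1 \<subseteq> {x. g (tensor x y) \<in> ?H}" by blast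
    then have "closure (Domain H\<^sub>1) \<subseteq> {x. g (tensor x y) \<in> ?H}"
      by (rule closure_minimal) (intro cl tensor.continuous_on continuous_on_const continuous_on_id)
    then show ?thesis using dense(1) by auto
  qed
  have "subspace {\<eta>. g \<eta> \<in> ?H}"
    using linear_subspace_vimage[OF bounded_linear.linear[OF g] tensor_sum_subspace] by (simp add: vimage_def)
  then have "closure (span {tensor x y | x y. True}) \<subseteq> {\<eta>. g \<eta> \<in> ?H}"
    using tens cl[OF continuous_on_id] by (intro closure_minimal span_minimal) auto
  then show "(B \<eta>, \<eta> + \<mu> *\<^sub>C B \<eta>) \<in> ?H" for \<eta>
    unfolding tensor_dense[OF tensor] g_def by blast
qed

lemma vector_derivative_line:
  assumes "open S" "t \<in> S" and "\<And>s. s \<in> S \<Longrightarrow> \<gamma> s = c * complex_of_real s"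
  shows "vector_derivative \<gamma> (at t) = c"
proof (rule vector_derivative_at)
  have "((\<lambda>s. c * complex_of_real s) has_vector_derivative c) (at t)"
    by (auto intro!: derivative_eq_intros)
  then show "(\<gamma> has_vector_derivative c) (at t)"
    by (rule has_vector_derivative_transform_within_open[OF _ assms(1,2)]) (simp add: assms(3))
qed

text \<open>On a ray of nonreal direction both imaginary parts grow linearly. The threshold on
  \<open>t\<close> ensures that \<mu> shifts the second one by at most half, which is the source of
  the factor 2.\<close>

lemma resolvent_product_decay:
  fixes P :: "complex \<Rightarrow> 'c::complex_inner \<Rightarrow>\<^sub>L 'c"
  assumes P: "Im z \<noteq> 0 \<Longrightarrow> norm (P z) \<le> 1 / \<bar>Im z\<bar>"
    and Q: "Im (\<mu> - z) \<noteq> 0 \<Longrightarrow> norm (Q (\<mu> - z)) \<le> 1 / \<bar>Im (\<mu> - z)\<bar>"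
    and z: "z = c * complex_of_real t" and c: "0 < Im c" and t: "2 * \<bar>Im \<mu>\<bar> / Im c < \<bar>t\<bar>"
  shows "norm (scaleC_blinfun c (P z o\<^sub>L Q (\<mu> - z))) \<le> cmod c * (2 / (Im c)\<^sup>2) / t\<^sup>2"
proof -
  have t0: "0 < \<bar>t\<bar>" using t c by (meson abs_ge_zero divide_nonneg_pos le_less_trans mult_nonneg_nonneg zero_le_numeral)
  have Imz: "\<bar>Im z\<bar> = Im c * \<bar>t\<bar>" using c by (simp add: z abs_mult)
  have "2 * \<bar>Im \<mu>\<bar> < Im c * \<bar>t\<bar>" using t c by (simp add: pos_divide_less_eq mult.commute)
  then have Imw: "Im c * \<bar>t\<bar> / 2 \<le> \<bar>Im (\<mu> - z)\<bar>"
    using Imz abs_triangle_ineq2_sym[of "Im z" "Im \<mu>"] by simp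
  have pos: "0 < Im c * \<bar>t\<bar>" using c t0 by simp
  have nP: "norm (P z) \<le> 1 / (Im c * \<bar>t\<bar>)" using P Imz pos by auto
  have nQ: "norm (Q (\<mu> - z)) \<le> 1 / (Im c * \<bar>t\<bar> / 2)"
  proof -
    have "norm (Q (\<mu> - z)) \<le> 1 / \<bar>Im (\<mu> - z)\<bar>" using Q Imw pos by fastforce
    also have "\<dots> \<le> 1 / (Im c * \<bar>t\<bar> / 2)" using Imw pos by (intro frac_le) auto
    finally show ?thesis .
  qed
  have "norm (scaleC_blinfun c (P z o\<^sub>L Q (\<mu> - z))) \<le> cmod c * (norm (P z) * norm (Q (\<mu> - z)))"
    by (intro order_trans[OF norm_scaleC_blinfun_le] mult_left_mono norm_blinfun_compose) simp
  also have "\<dots> \<le> cmod c * (1 / (Im c * \<bar>t\<bar>) * (1 / (Im c * \<bar>t\<bar> / 2)))"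
    using pos by (intro mult_left_mono mult_mono nP nQ) auto
  also have "\<dots> = cmod c * (2 / (Im c)\<^sup>2) / t\<^sup>2"
    by (simp add: power2_eq_square flip: abs_mult)
  finally show ?thesis .
qed

section \<open>The curve integral of the tensor product of resolvents\<close>

context
  fixes tensor :: "'a::complex_hilbert \<Rightarrow> 'b::complex_hilbert \<Rightarrow> 'c::complex_hilbert"
    and H\<^sub>1 :: "'a operator" and H\<^sub>2 :: "'b operator"
    and \<mu> c\<^sub>p c\<^sub>m :: complex and \<gamma> :: "real \<Rightarrow> complex" and T m\<^sub>1 m\<^sub>2 l\<^sub>1 l\<^sub>2 :: real
  assumes tensor: "hilbert_tensor_product tensor"
    and sa: "self_adjoint H\<^sub>1" "self_adjoint H\<^sub>2"
    and m1: "\<And>x u. (x, u) \<in> H\<^sub>1 \<Longrightarrow> m\<^sub>1 * (norm x)\<^sup>2 \<le> Re (cinner x u)"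
    and m2: "\<And>y v. (y, v) \<in> H\<^sub>2 \<Longrightarrow> m\<^sub>2 * (norm y)\<^sup>2 \<le> Re (cinner y v)"
    and l: "inf_spec H\<^sub>1 = ereal l\<^sub>1" "inf_spec H\<^sub>2 = ereal l\<^sub>2" "m\<^sub>1 \<le> l\<^sub>1" "m\<^sub>2 \<le> l\<^sub>2"
    and \<gamma>: "\<gamma> piecewise_C1_differentiable_on UNIV"
    and avoid: "\<And>t. \<gamma> t \<notin> right_ray (ereal l\<^sub>1)" "\<And>t. \<mu> - \<gamma> t \<notin> right_ray (ereal l\<^sub>2)"
    and T: "0 < T" and c: "0 < Im c\<^sub>p" "0 < Im c\<^sub>m"
    and \<gamma>p: "\<And>t. T \<le> t \<Longrightarrow> \<gamma> t = c\<^sub>p * complex_of_real t"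
    and \<gamma>m: "\<And>t. T \<le> - t \<Longrightarrow> \<gamma> t = c\<^sub>m * complex_of_real t"
begin

interpretation tensor: bounded_bilinear tensor
  by (rule bounded_bilinear_tensor[OF tensor])

private abbreviation (input) "U\<^sub>1 \<equiv> - right_ray (ereal l\<^sub>1)"
private abbreviation (input) "U\<^sub>2 \<equiv> - right_ray (ereal l\<^sub>2)"
private abbreviation (input) "U \<equiv> U\<^sub>1 \<inter> (\<lambda>z. \<mu> - z) -` U\<^sub>2"
private abbreviation (input) "F \<equiv> \<lambda>z. tensor_blinfun tensor (resolvent H\<^sub>1 z) (resolvent H\<^sub>2 (\<mu> - z))"

text \<open>\<open>tensor_blinfun\<close> is a definite description and says nothing until an
  operator with the required values is exhibited; the composite of R1 \<otimes> Id and Id \<otimes>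
  R2 is that operator, and its factors carry the norm bounds.\<close>

lemma tensor_resolvents_factor:
  obtains P Q :: "complex \<Rightarrow> 'c \<Rightarrow>\<^sub>L 'c"
  where "pseudo_resolvent U\<^sub>1 P" "pseudo_resolvent U\<^sub>2 Q"
    "\<And>z. z \<in> U\<^sub>1 \<Longrightarrow> norm (P z) \<le> norm (resolvent H\<^sub>1 z)"
    "\<And>z. z \<in> U\<^sub>2 \<Longrightarrow> norm (Q z) \<le> norm (resolvent H\<^sub>2 z)"
    "\<And>z. z \<in> U \<Longrightarrow> F z = P z o\<^sub>L Q (\<mu> - z)"
    "\<And>z x y. z \<in> U \<Longrightarrow> F z (tensor x y) = tensor (resolvent H\<^sub>1 z x) (resolvent H\<^sub>2 (\<mu> - z) y)"
proof -
  have pr: "pseudo_resolvent U\<^sub>1 (resolvent H\<^sub>1)" "pseudo_resolvent U\<^sub>2 (resolvent H\<^sub>2)"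
    using resolvent_off_ray[OF sa(1)] resolvent_off_ray[OF sa(2)] l(1,2)
    by (auto intro!: pseudo_resolvent_resolvent sa)
  obtain P :: "complex \<Rightarrow> 'c \<Rightarrow>\<^sub>L 'c" where P: "pseudo_resolvent U\<^sub>1 P"
    "\<And>z x y. z \<in> U\<^sub>1 \<Longrightarrow> P z (tensor x y) = tensor (resolvent H\<^sub>1 z x) y"
    "\<And>z. z \<in> U\<^sub>1 \<Longrightarrow> norm (P z) \<le> norm (resolvent H\<^sub>1 z)"
    using pseudo_resolvent_tensor_left[OF tensor pr(1)] by blast
  obtain Q :: "complex \<Rightarrow> 'c \<Rightarrow>\<^sub>L 'c" where Q: "pseudo_resolvent U\<^sub>2 Q"
    "\<And>z y x. z \<in> U\<^sub>2 \<Longrightarrow> Q z (tensor x y) = tensor x (resolvent H\<^sub>2 z y)"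
    "\<And>z. z \<in> U\<^sub>2 \<Longrightarrow> norm (Q z) \<le> norm (resolvent H\<^sub>2 z)"
    by (rule pseudo_resolvent_tensor_left[OF hilbert_tensor_product_flip[OF tensor] pr(2)]) (rule that)
  have eq: "F z = P z o\<^sub>L Q (\<mu> - z)" if "z \<in> U" for z
    by (rule tensor_blinfun_eqI[OF tensor]) (use that in \<open>simp add: P Q\<close>)
  have "F z (tensor x y) = tensor (resolvent H\<^sub>1 z x) (resolvent H\<^sub>2 (\<mu> - z) y)" if "z \<in> U" for z x y
    using that by (simp add: eq P Q)
  with P(1) Q(1) P(3) Q(3) eq show thesis by (rule that)
qed

private lemma avoid_U: "\<gamma> t \<in> U"
  using avoid by simp

private lemma open_U: "open U"
  by (intro open_Int open_off_ray open_vimage continuous_intros)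

private lemma velocity:
  "T < t \<Longrightarrow> vector_derivative \<gamma> (at t) = c\<^sub>p"
  "T < - t \<Longrightarrow> vector_derivative \<gamma> (at t) = c\<^sub>m"
  using vector_derivative_line[of "{T<..}" t \<gamma> c\<^sub>p] vector_derivative_line[of "{..<- T}" t \<gamma> c\<^sub>m] \<gamma>p \<gamma>m
  by (auto simp: open_lessThan open_greaterThan)

lemma curve_integrand_integrable: "curve_integrand \<gamma> F integrable_on UNIV"
proof -
  obtain P Q :: "complex \<Rightarrow> 'c \<Rightarrow>\<^sub>L 'c" where P: "pseudo_resolvent U\<^sub>1 P" and Q: "pseudo_resolvent U\<^sub>2 Q"
    and nP: "\<And>z. z \<in> U\<^sub>1 \<Longrightarrow> norm (P z) \<le> norm (resolvent H\<^sub>1 z)"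
    and nQ: "\<And>z. z \<in> U\<^sub>2 \<Longrightarrow> norm (Q z) \<le> norm (resolvent H\<^sub>2 z)"
    and F: "\<And>z. z \<in> U \<Longrightarrow> F z = P z o\<^sub>L Q (\<mu> - z)"
    using tensor_resolvents_factor by metis
  let ?F = "\<lambda>z. P z o\<^sub>L Q (\<mu> - z)"
  have eq: "curve_integrand \<gamma> F = curve_integrand \<gamma> ?F"
    using F[OF avoid_U] by (simp add: fun_eq_iff curve_integrand_def)
  have "curve_integrand \<gamma> ?F integrable_on cbox a b" for a b
    using avoid_U
    by (intro curve_integrand_integrable_on_interval[OF \<gamma> open_U] pseudo_resolvent_product_holomorphic[OF P Q open_U])
      auto
  moreover define C where "C c = cmod c * (2 / (Im c)\<^sup>2)" for c
  \<comment> \<open>Beyond \<open>N\<close> the curve runs on one of its two straight ends, and the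
    decay estimate applies to either direction.\<close>
  define N where "N = max T (max (2 * \<bar>Im \<mu>\<bar> / Im c\<^sub>p) (2 * \<bar>Im \<mu>\<bar> / Im c\<^sub>m))"
  have "norm (curve_integrand \<gamma> ?F t) \<le> max (C c\<^sub>p) (C c\<^sub>m) / t\<^sup>2" if t: "N < \<bar>t\<bar>" for t
  proof -
    have nP': "norm (P (\<gamma> t)) \<le> 1 / \<bar>Im (\<gamma> t)\<bar>" if "Im (\<gamma> t) \<noteq> 0"
      using nP[of "\<gamma> t"] resolvent_nonreal(2)[OF sa(1) that] avoid(1)[of t] by simp
    have nQ': "norm (Q (\<mu> - \<gamma> t)) \<le> 1 / \<bar>Im (\<mu> - \<gamma> t)\<bar>" if "Im (\<mu> - \<gamma> t) \<noteq> 0"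
      using nQ[of "\<mu> - \<gamma> t"] resolvent_nonreal(2)[OF sa(2) that] avoid(2)[of t] by simp
    have "T < \<bar>t\<bar>" using t by (simp add: N_def)
    then consider "T < t" | "T < - t" by linarith
    then obtain c where c: "c \<in> {c\<^sub>p, c\<^sub>m}" "\<gamma> t = c * complex_of_real t" "vector_derivative \<gamma> (at t) = c"
      by cases (use velocity[of t] \<gamma>p[of t] \<gamma>m[of t] in auto)
    have "0 < Im c" "2 * \<bar>Im \<mu>\<bar> / Im c < \<bar>t\<bar>"
      using c(1) \<open>0 < Im c\<^sub>p\<close> \<open>0 < Im c\<^sub>m\<close> t by (auto simp: N_def)
    then have "norm (scaleC_blinfun c (P (\<gamma> t) o\<^sub>L Q (\<mu> - \<gamma> t))) \<le> cmod c * (2 / (Im c)\<^sup>2) / t\<^sup>2"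
      using nP' nQ' c(2) by (intro resolvent_product_decay) auto
    then have "norm (curve_integrand \<gamma> ?F t) \<le> C c / t\<^sup>2"
      by (simp add: curve_integrand_def c(3) C_def)
    also have "\<dots> \<le> max (C c\<^sub>p) (C c\<^sub>m) / t\<^sup>2"
      using c(1) by (intro divide_right_mono) auto
    finally show ?thesis .
  qed
  moreover have "0 < N" using T by (simp add: N_def)
  ultimately show ?thesis
    unfolding eq by (intro integrable_on_UNIV_inverse_square_decay)
qed

text \<open>The resolvent equations produce z and \<mu> - z times the same tensor, and these
  multiples add up to \<mu> times it. The scalar \<open>a\<close> leaves room for the velocity of
  the curve.\<close>

lemma tensor_resolvents_domain:
  assumes z: "z \<in> U" and xu: "(x, u) \<in> H\<^sub>1" and yv: "(y, v) \<in> H\<^sub>2"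
  defines "\<zeta> \<equiv> tensor u y + tensor x v - \<mu> *\<^sub>C tensor x y"
  shows "F z \<zeta> = tensor x (resolvent H\<^sub>2 (\<mu> - z) y) + tensor (resolvent H\<^sub>1 z x) y"
    and "(a *\<^sub>C F z (tensor x y), a *\<^sub>C (F z \<zeta> + \<mu> *\<^sub>C F z (tensor x y))) \<in> tensor_sum tensor H\<^sub>1 H\<^sub>2"
proof -
  obtain P Q :: "complex \<Rightarrow> 'c \<Rightarrow>\<^sub>L 'c" where P: "pseudo_resolvent U\<^sub>1 P" and Q: "pseudo_resolvent U\<^sub>2 Q"
    and F: "F z = P z o\<^sub>L Q (\<mu> - z)"
    and FT: "\<And>x y. F z (tensor x y) = tensor (resolvent H\<^sub>1 z x) (resolvent H\<^sub>2 (\<mu> - z) y)"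
    using tensor_resolvents_factor z by metis
  have FC: "F z (c *\<^sub>C v) = c *\<^sub>C F z v" for c v
    using P Q z unfolding F pseudo_resolvent_def clinear_blinfun_def by simp
  have "z \<notin> right_ray (inf_spec H\<^sub>1)" "\<mu> - z \<notin> right_ray (inf_spec H\<^sub>2)" using z l by auto
  note R1 = resolvent_apply_domain[OF sa(1) this(1)] and R2 = resolvent_apply_domain[OF sa(2) this(2)]
  define X Y where "X = resolvent H\<^sub>1 z x" and "Y = resolvent H\<^sub>2 (\<mu> - z) y"
  have "F z \<zeta> = tensor (x + z *\<^sub>C X) Y + tensor X (y + (\<mu> - z) *\<^sub>C Y) - \<mu> *\<^sub>C tensor X Y"
    unfolding \<zeta>_def by (simp add: blinfun.diff_right blinfun.add_right FC FT R1(1)[OF xu] R2(1)[OF yv] X_def Y_def)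
  also have "\<dots> = tensor x Y + tensor X y"
    by (simp add: tensor.add_left tensor.add_right tensor_scaleC_left[OF tensor]
        tensor_scaleC_right[OF tensor]) (simp add: scaleC.diff_left)
  finally show F\<zeta>: "F z \<zeta> = tensor x (resolvent H\<^sub>2 (\<mu> - z) y) + tensor (resolvent H\<^sub>1 z x) y"
    by (simp add: X_def Y_def)
  have "(tensor (a *\<^sub>C X) Y, tensor (a *\<^sub>C (x + z *\<^sub>C X)) Y + tensor (a *\<^sub>C X) (y + (\<mu> - z) *\<^sub>C Y))
      \<in> tensor_sum tensor H\<^sub>1 H\<^sub>2"
    unfolding X_def Y_def by (intro tensor_sum_generator self_adjoint_scaleC[OF sa(1)] R1(2) R2(2))
  also have "tensor (a *\<^sub>C X) Y = a *\<^sub>C F z (tensor x y)"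
    by (simp add: FT X_def Y_def tensor_scaleC_left[OF tensor])
  also have "tensor (a *\<^sub>C (x + z *\<^sub>C X)) Y + tensor (a *\<^sub>C X) (y + (\<mu> - z) *\<^sub>C Y)
      = a *\<^sub>C (F z \<zeta> + \<mu> *\<^sub>C F z (tensor x y))"
    unfolding F\<zeta> FT X_def[symmetric] Y_def[symmetric]
    by (simp add: tensor.add_left tensor.add_right tensor_scaleC_left[OF tensor]
        tensor_scaleC_right[OF tensor] scaleC.add_right) (simp add: scaleC_scaleC algebra_simps flip: scaleC.add_left)
  finally show "(a *\<^sub>C F z (tensor x y), a *\<^sub>C (F z \<zeta> + \<mu> *\<^sub>C F z (tensor x y))) \<in> tensor_sum tensor H\<^sub>1 H\<^sub>2" .
qed

lemma curve_integral_on_domain: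
  assumes xu: "(x, u) \<in> H\<^sub>1" and yv: "(y, v) \<in> H\<^sub>2"
  shows "curve_integral \<gamma> F (tensor u y + tensor x v - \<mu> *\<^sub>C tensor x y)
    = (2 * complex_of_real pi * \<i>) *\<^sub>C tensor x y"
proof -
  define \<zeta> where "\<zeta> = tensor u y + tensor x v - \<mu> *\<^sub>C tensor x y"
  define I where "I = curve_integral \<gamma> F"
  have "cinner \<theta> (I \<zeta>) = 2 * complex_of_real pi * \<i> * cinner \<theta> (tensor x y)" for \<theta>
  proof -
    define p where "p = cinner \<theta> (tensor x y)"
    define f where "f t = cinner \<theta> (curve_integrand \<gamma> F t \<zeta>)" for t
    have bl1: "bounded_linear (\<lambda>x. cinner \<theta> (tensor x y))"
      by (rule bounded_linear_compose[OF cinner.bounded_linear_right tensor.bounded_linear_left])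
    have sc1: "cinner \<theta> (tensor (c *\<^sub>C x) y) = c * cinner \<theta> (tensor x y)" for c x
      by (simp add: tensor_scaleC_left[OF tensor] cinner_scaleC_right)
    obtain K\<^sub>1 where K1: "\<And>z. z \<notin> right_ray (ereal l\<^sub>1) \<Longrightarrow> (K\<^sub>1 has_field_derivative cinner \<theta> (tensor (resolvent H\<^sub>1 z x) y)) (at z)"
      and lim1: "\<And>d e d' e'. Im e \<noteq> 0 \<Longrightarrow> Im e' \<noteq> 0 \<Longrightarrow>
        (\<lambda>n. K\<^sub>1 (d + of_real (real n) * e) - K\<^sub>1 (d' + of_real (real n) * e')) \<longlonglongrightarrow> p * (Ln (- e') - Ln (- e))"
      unfolding p_def
      using resolvent_primitive[OF sa(1) m1 l(1,3) bl1 sc1 xu] by blast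
    have bl2: "bounded_linear (\<lambda>y. cinner \<theta> (tensor x y))"
      by (rule bounded_linear_compose[OF cinner.bounded_linear_right tensor.bounded_linear_right])
    have sc2: "cinner \<theta> (tensor x (c *\<^sub>C y)) = c * cinner \<theta> (tensor x y)" for c y
      by (simp add: tensor_scaleC_right[OF tensor] cinner_scaleC_right)
    obtain K\<^sub>2 where K2: "\<And>z. z \<notin> right_ray (ereal l\<^sub>2) \<Longrightarrow> (K\<^sub>2 has_field_derivative cinner \<theta> (tensor x (resolvent H\<^sub>2 z y))) (at z)"
      and lim2: "\<And>d e d' e'. Im e \<noteq> 0 \<Longrightarrow> Im e' \<noteq> 0 \<Longrightarrow>
        (\<lambda>n. K\<^sub>2 (d + of_real (real n) * e) - K\<^sub>2 (d' + of_real (real n) * e')) \<longlonglongrightarrow> p * (Ln (- e') - Ln (- e))"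
      unfolding p_def
      using resolvent_primitive[OF sa(2) m2 l(2,4) bl2 sc2 yv] by blast
    \<comment> \<open>The minus sign compensates the derivative -1 of \<mu> - z, so that both
      summands of F(z) \<zeta> appear with sign plus.\<close>
    define G where "G z = K\<^sub>1 z - K\<^sub>2 (\<mu> - z)" for z
    have G: "(G has_field_derivative cinner \<theta> (F z \<zeta>)) (at z)" if z: "z \<in> U" for z
    proof -
      have "((\<lambda>z. K\<^sub>2 (\<mu> - z)) has_field_derivative cinner \<theta> (tensor x (resolvent H\<^sub>2 (\<mu> - z) y)) * (- 1)) (at z)"
        by (rule DERIV_chain'[of "\<lambda>z. \<mu> - z" "- 1" z UNIV K\<^sub>2])
          (use K2 z in \<open>auto intro!: derivative_eq_intros\<close>)
      from DERIV_diff[OF K1 this] z show ?thesis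
        unfolding G_def \<zeta>_def tensor_resolvents_domain(1)[OF z xu yv]
        by (simp add: cinner.add_right add.commute)
    qed
    obtain S where cont\<gamma>: "continuous_on UNIV \<gamma>" and S: "finite S" "\<gamma> C1_differentiable_on (UNIV - S)"
      using \<gamma> unfolding piecewise_C1_differentiable_on_def by blast
    have fG: "(f has_integral (G \<circ> \<gamma>) (real n) - (G \<circ> \<gamma>) (- real n)) {- real n..real n}" for n
    proof (rule fundamental_theorem_of_calculus_interior_strong[OF S(1)])
      fix t assume "t \<in> {- real n<..<real n} - S"
      then have "(\<gamma> has_vector_derivative vector_derivative \<gamma> (at t)) (at t)"
        using S(2) vector_derivative_works unfolding C1_differentiable_on_eq by blast
      from field_vector_diff_chain_at[OF this G[OF avoid_U]]
      show "((G \<circ> \<gamma>) has_vector_derivative f t) (at t)"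
        by (simp add: f_def curve_integrand_def blinfun_apply_scaleC_blinfun cinner_scaleC_right)
    next
      have "continuous_on U G"
        by (intro continuous_at_imp_continuous_on ballI DERIV_isCont[OF G])
      then show "continuous_on {- real n..real n} (G \<circ> \<gamma>)"
        unfolding o_def
        by (rule continuous_on_compose2[OF _ continuous_on_subset[OF cont\<gamma> subset_UNIV]]) (use avoid_U in blast)
    qed simp
    have "(curve_integrand \<gamma> F has_integral I) UNIV"
      unfolding I_def curve_integral_def by (rule integrable_integral[OF curve_integrand_integrable])
    from has_integral_linear[OF this bounded_linear_matrix_element[of \<theta> \<zeta>]]
    have "(f has_integral cinner \<theta> (I \<zeta>)) UNIV" by (simp add: f_def[abs_def] o_def)
    from has_integral_UNIV_LIMSEQ[OF this fG]
    have "(\<lambda>n. (G \<circ> \<gamma>) (real n) - (G \<circ> \<gamma>) (- real n)) \<longlonglongrightarrow> cinner \<theta> (I \<zeta>)" .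
    moreover have "(\<lambda>n. (G \<circ> \<gamma>) (real n) - (G \<circ> \<gamma>) (- real n)) \<longlonglongrightarrow> 2 * complex_of_real pi * \<i> * p"
    proof (rule Lim_transform_eventually)
      \<comment> \<open>At parameter -n the curve is at \<open>n * (- c\<^sub>m)\<close>, and the
        reflection \<mu> - z reverses both directions; this puts every endpoint on a line d + n e
        with e nonreal.\<close>
      let ?k1 = "\<lambda>n. K\<^sub>1 (0 + of_real (real n) * c\<^sub>p) - K\<^sub>1 (0 + of_real (real n) * (- c\<^sub>m))"
      let ?k2 = "\<lambda>n. K\<^sub>2 (\<mu> + of_real (real n) * (- c\<^sub>p)) - K\<^sub>2 (\<mu> + of_real (real n) * c\<^sub>m)"
      have "(\<lambda>n. ?k1 n - ?k2 n) \<longlonglongrightarrow> p * (Ln (- (- c\<^sub>m)) - Ln (- c\<^sub>p)) - p * (Ln (- c\<^sub>m) - Ln (- (- c\<^sub>p)))"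
        by (rule tendsto_diff[OF lim1 lim2]) (use c in auto)
      also have "p * (Ln (- (- c\<^sub>m)) - Ln (- c\<^sub>p)) - p * (Ln (- c\<^sub>m) - Ln (- (- c\<^sub>p))) = 2 * complex_of_real pi * \<i> * p"
        using c by (simp add: Ln_uminus_upper algebra_simps)
      finally show "(\<lambda>n. ?k1 n - ?k2 n) \<longlonglongrightarrow> 2 * complex_of_real pi * \<i> * p" .
      obtain n0 where n0: "T \<le> real n0" using real_arch_simple by blast
      have "?k1 n - ?k2 n = (G \<circ> \<gamma>) (real n) - (G \<circ> \<gamma>) (- real n)" if "n0 \<le> n" for n
        using \<gamma>p[of "real n"] \<gamma>m[of "- real n"] n0 that by (simp add: G_def mult.commute)
      then show "\<forall>\<^sub>F n in sequentially. ?k1 n - ?k2 n = (G \<circ> \<gamma>) (real n) - (G \<circ> \<gamma>) (- real n)"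
        unfolding eventually_sequentially by blast
    qed
    ultimately show ?thesis unfolding p_def by (rule LIMSEQ_unique)
  qed
  then have "cinner \<theta> (I \<zeta> - (2 * complex_of_real pi * \<i>) *\<^sub>C tensor x y) = 0" for \<theta>
    by (simp add: cinner.diff_right cinner_scaleC_right)
  then have "I \<zeta> - (2 * complex_of_real pi * \<i>) *\<^sub>C tensor x y = 0"
    by (rule cinner_eq_0_imp)
  then show ?thesis by (simp add: I_def \<zeta>_def)
qed

lemma is_resolvent_curve_integral:
  "is_resolvent (tensor_sum tensor H\<^sub>1 H\<^sub>2) \<mu>
    (scaleC_blinfun (1 / (2 * complex_of_real pi * \<i>)) (curve_integral \<gamma> F))"
proof (rule is_resolvent_tensor_sum[OF tensor])
  define k where "k = 1 / (2 * complex_of_real pi * \<i>)"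
  have k: "k * (2 * complex_of_real pi * \<i>) = 1" by (simp add: k_def)
  define I where "I = curve_integral \<gamma> F"
  show "closure (Domain H\<^sub>1) = UNIV" "closure (Domain H\<^sub>2) = UNIV"
    using sa by (simp_all add: self_adjoint_def)
  fix x u y v assume xy: "(x, u) \<in> H\<^sub>1" "(y, v) \<in> H\<^sub>2"
  define \<zeta> where "\<zeta> = tensor u y + tensor x v - \<mu> *\<^sub>C tensor x y"
  have I\<zeta>: "k *\<^sub>C I \<zeta> = tensor x y"
    unfolding I_def \<zeta>_def curve_integral_on_domain[OF xy] scaleC_scaleC k by simp
  then show "scaleC_blinfun (1 / (2 * complex_of_real pi * \<i>)) (curve_integral \<gamma> F)
      (tensor u y + tensor x v - \<mu> *\<^sub>C tensor x y) = tensor x y"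
    by (simp add: blinfun_apply_scaleC_blinfun k_def I_def \<zeta>_def)
  \<comment> \<open>The candidate pair (B (x \<otimes> y), H B (x \<otimes> y)) as a bounded linear
    function of the operator. It lies in the graph for every value of the integrand, hence for the
    integral.\<close>
  define h where "h A = (k *\<^sub>C blinfun_apply A (tensor x y),
    k *\<^sub>C (blinfun_apply A \<zeta> + \<mu> *\<^sub>C blinfun_apply A (tensor x y)))" for A :: "'c \<Rightarrow>\<^sub>L 'c"
  have "bounded_linear h"
    unfolding h_def
    by (intro bounded_linear_Pair bounded_linear_add blinfun.bounded_linear_left
        bounded_linear_compose[OF bounded_linear_scaleC])
  moreover have "(curve_integrand \<gamma> F has_integral I) UNIV"
    unfolding I_def curve_integral_def by (rule integrable_integral[OF curve_integrand_integrable])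
  ultimately have "((h \<circ> curve_integrand \<gamma> F) has_integral h I) UNIV"
    by (rule has_integral_linear[rotated])
  then have "h I \<in> tensor_sum tensor H\<^sub>1 H\<^sub>2"
  proof (rule has_integral_closed_subspace[OF tensor_sum_subspace tensor_sum_closed])
    fix t
    let ?a = "k * vector_derivative \<gamma> (at t)"
    have "(h \<circ> curve_integrand \<gamma> F) t
        = (?a *\<^sub>C F (\<gamma> t) (tensor x y), ?a *\<^sub>C (F (\<gamma> t) \<zeta> + \<mu> *\<^sub>C F (\<gamma> t) (tensor x y)))"
      by (simp add: h_def curve_integrand_def blinfun_apply_scaleC_blinfun scaleC_scaleC scaleC.add_right
          ac_simps)
    also have "\<dots> \<in> tensor_sum tensor H\<^sub>1 H\<^sub>2"
      unfolding \<zeta>_def by (rule tensor_resolvents_domain(2)[OF avoid_U xy])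
    finally show "(h \<circ> curve_integrand \<gamma> F) t \<in> tensor_sum tensor H\<^sub>1 H\<^sub>2" .
  qed
  also have "h I = (k *\<^sub>C I (tensor x y), tensor x y + \<mu> *\<^sub>C k *\<^sub>C I (tensor x y))"
    by (simp add: h_def scaleC.add_right I\<zeta> scaleC_scaleC mult.commute)
  finally show "(scaleC_blinfun (1 / (2 * complex_of_real pi * \<i>)) (curve_integral \<gamma> F) (tensor x y),
      tensor x y + \<mu> *\<^sub>C scaleC_blinfun (1 / (2 * complex_of_real pi * \<i>)) (curve_integral \<gamma> F) (tensor x y))
      \<in> tensor_sum tensor H\<^sub>1 H\<^sub>2"
    by (simp add: blinfun_apply_scaleC_blinfun k_def I_def)
qed

end

theorem mainTheorem1:
  fixes tensor :: "'a::complex_hilbert \<Rightarrow> 'b::complex_hilbert \<Rightarrow> 'c::complex_hilbert"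
    and H\<^sub>1 :: "'a operator" and H\<^sub>2 :: "'b operator"
    and \<mu> c\<^sub>p c\<^sub>m :: complex and \<gamma> :: "real \<Rightarrow> complex" and T :: real
  assumes "hilbert_tensor_product tensor"
    and "self_adjoint H\<^sub>1" and "bounded_below H\<^sub>1"
    and "self_adjoint H\<^sub>2" and "bounded_below H\<^sub>2"
    and "\<mu> \<notin> right_ray (inf_spec H\<^sub>1 + inf_spec H\<^sub>2)"
    and "\<gamma> piecewise_C1_differentiable_on UNIV"
    and "range \<gamma> \<inter> (right_ray (inf_spec H\<^sub>1) \<union> (\<lambda>a. \<mu> - a) ` right_ray (inf_spec H\<^sub>2)) = {}"
    and "T > 0" and "Im c\<^sub>p > 0" and "Im c\<^sub>m > 0"
    and "\<And>t. t \<ge> T \<Longrightarrow> \<gamma> t = c\<^sub>p * complex_of_real t"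
    and "\<And>t. - t \<ge> T \<Longrightarrow> \<gamma> t = c\<^sub>m * complex_of_real t"
  shows "let H = tensor_sum tensor H\<^sub>1 H\<^sub>2;
             F = (\<lambda>\<mu>\<^sub>1. tensor_blinfun tensor (resolvent H\<^sub>1 \<mu>\<^sub>1) (resolvent H\<^sub>2 (\<mu> - \<mu>\<^sub>1)))
         in \<mu> \<in> resolvent_set H \<and>
            curve_integrable \<gamma> F \<and>
            resolvent H \<mu> = scaleC_blinfun (1 / (2 * complex_of_real pi * \<i>)) (curve_integral \<gamma> F)"
proof -
  note tensor = assms(1)
  interpret tensor: bounded_bilinear tensor by (rule bounded_bilinear_tensor[OF tensor])
  define H where "H = tensor_sum tensor H\<^sub>1 H\<^sub>2"
  define F where "F = (\<lambda>\<mu>\<^sub>1. tensor_blinfun tensor (resolvent H\<^sub>1 \<mu>\<^sub>1) (resolvent H\<^sub>2 (\<mu> - \<mu>\<^sub>1)))"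
  have "is_resolvent H \<mu> (scaleC_blinfun (1 / (2 * complex_of_real pi * \<i>)) (curve_integral \<gamma> F)) \<and>
    curve_integrable \<gamma> F"
  \<comment> \<open>On a zero factor the spectral infimum is \<infinity>, so no real endpoint of the
    ray exists. The tensor product is then zero as well, and every bounded operator on it is a
    resolvent.\<close>
  proof (cases "(\<forall>x::'a. x = 0) \<or> (\<forall>y::'b. y = 0)")
    case True
    have "tensor x y = 0" for x y
      using True
    proof
      assume "\<forall>x::'a. x = 0"
      then have "x = 0" by blast
      then show ?thesis by (simp add: tensor.zero_left)
    next
      assume "\<forall>y::'b. y = 0"
      then have "y = 0" by blast
      then show ?thesis by (simp add: tensor.zero_right)
    qed
    then have "span {tensor x y | x y. True} \<subseteq> {0}"
      by (intro span_minimal) auto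
    then have "closure (span {tensor x y | x y. True}) \<subseteq> {0}"
      by (simp add: closure_minimal)
    then have zero: "z = 0" for z :: 'c
      unfolding tensor_dense[OF tensor] by blast
    have eq: "z = z'" for z z' :: 'c
      using zero[of z] zero[of z'] by simp
    have "curve_integrand \<gamma> F = (\<lambda>t. 0)"
      by (intro ext blinfun_eqI eq)
    then have "curve_integrable \<gamma> F"
      by (simp add: curve_integrable_def integrable_0)
    moreover have "(z, z') \<in> H" for z z'
    proof -
      have "(0, 0) \<in> H"
        unfolding H_def using subspace_0[OF tensor_sum_subspace] by (simp add: zero_prod_def)
      then show ?thesis by (simp only: eq[of z 0] eq[of z' 0])
    qed
    then have "is_resolvent H \<mu> B" for B
      unfolding is_resolvent_iff by (intro conjI allI impI eq)
    ultimately show ?thesis by blast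
  next
    case False
    then obtain x0 :: 'a and y0 :: 'b where ne: "x0 \<noteq> 0" "y0 \<noteq> 0" by blast
    obtain m1 where m1: "\<And>x u. (x, u) \<in> H\<^sub>1 \<Longrightarrow> m1 * (norm x)\<^sup>2 \<le> Re (cinner x u)"
      using assms(3) unfolding bounded_below_def by blast
    obtain m2 where m2: "\<And>x u. (x, u) \<in> H\<^sub>2 \<Longrightarrow> m2 * (norm x)\<^sup>2 \<le> Re (cinner x u)"
      using assms(5) unfolding bounded_below_def by blast
    obtain l1 where l1: "inf_spec H\<^sub>1 = ereal l1" "m1 \<le> l1"
      using inf_spec_real[OF assms(2) m1 ne(1)] by blast
    obtain l2 where l2: "inf_spec H\<^sub>2 = ereal l2" "m2 \<le> l2"
      using inf_spec_real[OF assms(4) m2 ne(2)] by blast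
    have avoid: "\<gamma> t \<notin> right_ray (ereal l1)" "\<mu> - \<gamma> t \<notin> right_ray (ereal l2)" for t
    proof -
      have "\<gamma> t \<in> range \<gamma>" by simp
      with assms(8) have *: "\<gamma> t \<notin> right_ray (inf_spec H\<^sub>1)" "\<gamma> t \<notin> (\<lambda>a. \<mu> - a) ` right_ray (inf_spec H\<^sub>2)"
        by blast+
      show "\<gamma> t \<notin> right_ray (ereal l1)" using *(1) l1 by simp
      show "\<mu> - \<gamma> t \<notin> right_ray (ereal l2)"
      proof
        assume "\<mu> - \<gamma> t \<in> right_ray (ereal l2)"
        then have "\<mu> - (\<mu> - \<gamma> t) \<in> (\<lambda>a. \<mu> - a) ` right_ray (inf_spec H\<^sub>2)"
          unfolding l2(1) by (rule imageI)
        with *(2) show False by simp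
      qed
    qed
    note args = tensor assms(2,4) m1 m2 l1(1) l2(1) l1(2) l2(2) assms(7) avoid assms(9-13)
    show ?thesis
      unfolding H_def F_def curve_integrable_def
      using is_resolvent_curve_integral[OF args] curve_integrand_integrable[OF args] by blast
  qed
  then show ?thesis
    unfolding Let_def H_def[symmetric] F_def[symmetric]
    using resolvent_eqI by (auto simp: resolvent_set_def)
qed

end
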